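(* Let $n\in\mathbb{N}$ ($n\ge1$) and let $h$ be the heat kernel associated with $\mathcal{L}$ on $\mathbb{H}^n$. Then for every $i\in\{1,\dots,2n\}$ $$\int_{\mathbb{H}^n}x_i^4\,h(1,x)\,dx=12\qquad\text{and}\qquad\int_{\mathbb{H}^n}x_{2n+1}^2\,h(1,x)\,dx=n.$$
   Context: $\mathbb{H}^n=\mathbb{R}^{2n+1}$ is the Heisenberg group with product $(x_1,\dots,x_{2n+1})(y_1,\dots,y_{2n+1})=\big(x_1+y_1,\dots,x_{2n}+y_{2n},\,x_{2n+1}+y_{2n+1}+\frac12\sum_{i=1}^n(x_iy_{i+n}-x_{i+n}y_i)\big)$. Left-invariant fields: $X_j=\partial_{x_j}-\frac12x_{j+n}\partial_{x_{2n+1}}$, $Y_j=\partial_{x_{n+j}}+\frac12x_j\partial_{x_{2n+1}}$, $1\le j\le n$; $\mathcal{L}=-\sum_{j=1}^n(X_j^2+Y_j^2)$. The heat kernel $h(t,x)$ is the fundamental solution of $\partial_t+\mathcal{L}$ on $\mathbb{R}\times\mathbb{H}^n$ with $h=0$ for $t\le0$; it is non-negative and $\int_{\mathbb{H}^n}h(t,x)dx=1$ for $t>0$. $dx$ is Lebesgue measure. *)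

theory Defs
  imports "HOL-Analysis.Analysis"
begin

text \<open>
  The Heisenberg group \<open>H^n = R^(2n+1)\<close> with \<open>n = CARD('n)\<close>.  The index \<open>Some (Inl j)\<close>
  stands for \<open>x_j\<close>, \<open>Some (Inr j)\<close> for \<open>x_(j+n)\<close>, and \<open>None\<close> for \<open>x_(2n+1)\<close>; thus \<open>Some i\<close>
  with \<open>i :: 'n + 'n\<close> ranges over exactly the first \<open>2n\<close> coordinates.
\<close>

type_synonym 'n heis = "real ^ ('n + 'n) option"

definition partial_deriv :: "'m::finite \<Rightarrow> (real ^ 'm \<Rightarrow> real) \<Rightarrow> real ^ 'm \<Rightarrow> real" where
  "partial_deriv i f x = frechet_derivative f (at x) (axis i 1)"

definition heis_X :: "'n::finite \<Rightarrow> ('n heis \<Rightarrow> real) \<Rightarrow> 'n heis \<Rightarrow> real" where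
  "heis_X j f x =
     partial_deriv (Some (Inl j)) f x - 1/2 * x $ Some (Inr j) * partial_deriv None f x"

definition heis_Y :: "'n::finite \<Rightarrow> ('n heis \<Rightarrow> real) \<Rightarrow> 'n heis \<Rightarrow> real" where
  "heis_Y j f x =
     partial_deriv (Some (Inr j)) f x + 1/2 * x $ Some (Inl j) * partial_deriv None f x"

definition sub_laplacian :: "('n::finite heis \<Rightarrow> real) \<Rightarrow> 'n heis \<Rightarrow> real" where
  "sub_laplacian f x = - (\<Sum>j\<in>UNIV. heis_X j (heis_X j f) x + heis_Y j (heis_Y j f) x)"

primrec times_cont_diff :: "nat \<Rightarrow> ('a::euclidean_space \<Rightarrow> real) \<Rightarrow> bool" where
  "times_cont_diff 0 f \<longleftrightarrow> continuous_on UNIV f"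
| "times_cont_diff (Suc k) f \<longleftrightarrow>
     (\<forall>x. f differentiable (at x)) \<and>
     (\<forall>b\<in>Basis. times_cont_diff k (\<lambda>x. frechet_derivative f (at x) b))"

definition test_function :: "('a::euclidean_space \<Rightarrow> real) \<Rightarrow> bool" where
  "test_function \<phi> \<longleftrightarrow> (\<forall>k. times_cont_diff k \<phi>) \<and> compact (closure {x. \<phi> x \<noteq> 0})"

definition locally_integrable :: "('a::euclidean_space \<Rightarrow> real) \<Rightarrow> bool" where
  "locally_integrable f \<longleftrightarrow> (\<forall>K. compact K \<longrightarrow> set_integrable lborel K f)"

text \<open>
  The formal transpose of \<open>\<partial>_t + L\<close> is \<open>- \<partial>_t + L\<close>: the coefficients of \<open>X_j\<close> and \<open>Y_j\<close> do not
  depend on the variable they multiply the derivative in, so these fields are divergence free,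
  their transposes are \<open>- X_j\<close> and \<open>- Y_j\<close>, and \<open>L\<close> is its own transpose.
\<close>

definition heat_transpose :: "(real \<times> 'n::finite heis \<Rightarrow> real) \<Rightarrow> real \<times> 'n heis \<Rightarrow> real" where
  "heat_transpose \<phi> = (\<lambda>(t, x). - deriv (\<lambda>s. \<phi> (s, x)) t + sub_laplacian (\<lambda>y. \<phi> (t, y)) x)"

text \<open>
  \<open>(\<partial>_t + L) h\<close> is the Dirac distribution at the origin of \<open>R \<times> H^n\<close>, in the sense of distributions.
\<close>

definition fundamental_solution :: "(real \<Rightarrow> 'n::finite heis \<Rightarrow> real) \<Rightarrow> bool" where
  "fundamental_solution h \<longleftrightarrow>
     locally_integrable (\<lambda>(t, x). h t x) \<and>
     (\<forall>\<phi>. test_function \<phi> \<longrightarrow>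
        (LINT (t, x)|lborel. h t x * heat_transpose \<phi> (t, x)) = \<phi> (0, 0))"

text \<open>
  The distributional equation determines \<open>h\<close> only almost everywhere on \<open>R \<times> H^n\<close>, and only up to
  null solutions of the heat equation.  Continuity for \<open>t > 0\<close> selects the usual (in fact smooth)
  representative, which gives a meaning to the slices \<open>h t\<close>; positivity and unit mass exclude the
  null solutions.
\<close>

definition heat_kernel :: "(real \<Rightarrow> 'n::finite heis \<Rightarrow> real) \<Rightarrow> bool" where
  "heat_kernel h \<longleftrightarrow>
     fundamental_solution h \<and>
     continuous_on ({0<..} \<times> UNIV) (\<lambda>(t, x). h t x) \<and>
     (\<forall>t x. t \<le> 0 \<longrightarrow> h t x = 0) \<and>
     (\<forall>t x. 0 \<le> h t x) \<and>
     (\<forall>t>0. (LINT x|lborel. h t x) = 1)"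

end

theory Submission
  imports Defs "HOL-Computational_Algebra.Polynomial"
begin

text \<open>
  Write \<open>z\<close> for the last coordinate and \<open>\<Delta> = - \<L>\<close> for the sum of the squares of the \<open>2n\<close>
  horizontal fields.  The moments of the heat kernel follow from the evolution law
  \<open>d/dt (\<integral> p h(t)) = \<integral> (\<Delta> p) h(t)\<close>: since \<open>\<Delta> x_i^2 = 2\<close>, \<open>\<Delta> x_i^4 = 12 x_i^2\<close> and
  \<open>\<Delta> z^2 = (x_1^2 + ... + x_(2n)^2) / 2\<close>, and all these polynomials vanish at the origin,
  integrating in time gives in turn \<open>2 t\<close> for \<open>x_i^2\<close>, then \<open>12 t^2\<close> for \<open>x_i^4\<close> and
  \<open>n t^2\<close> for \<open>z^2\<close>.

  The work lies in justifying the evolution law, because the defining equation of \<open>h\<close> only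
  concerns test functions on space-time, and no moment is known to be finite beforehand.

  For a compactly supported smooth \<open>\<psi>\<close> the law is \<open>duhamel\<close>.  Test functions that are products
  of \<open>\<psi>\<close> with a function of time turn the equation into one for the continuous function
  \<open>t \<mapsto> \<integral> \<psi> h(t)\<close>; testing against bumps in time concentrated near \<open>t\<close> yields the identity
  at every single \<open>t > 0\<close>, which is what makes a statement about the slice \<open>t = 1\<close> possible.

  For a polynomial the law is \<open>moment_formula\<close>.  The cutoffs are functions of \<open>N / R\<close>, where
  \<open>N = (x_1^2 + ... + x_(2n)^2)^2 + 16 z^2\<close> is homogeneous of degree \<open>4\<close> under the dilations
  \<open>(x, z) \<mapsto> (r x, r^2 z)\<close> and \<open>\<Delta>\<close> lowers the degree by \<open>2\<close>.  So for a \<open>p\<close> of degree \<open>d\<close> the function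
  \<open>\<Delta> (p \<chi>(N / R))\<close> is bounded, uniformly in \<open>R\<close>, by a multiple of a weight of degree \<open>d - 2\<close>: the
  constant \<open>1\<close> for \<open>x_i^2\<close>, and \<open>x_1^2 + ... + x_(2n)^2\<close> for \<open>x_i^4\<close> and \<open>z^2\<close>.  The unit mass of \<open>h(t)\<close>
  thus controls the second moments, and these control the two moments of degree \<open>4\<close>; at each stage
  dominated convergence treats the right-hand side and monotone convergence the left.
\<close>

section \<open>Smooth functions\<close>

text \<open>
  An inductive definition gives the closure properties of smooth functions at once: the
  derivatives of a function built by these rules are built by them again, so by induction on the
  order all derivatives exist and are continuous.  The last rule admits functions known through
  their derivative, such as an antiderivative of a bump.
\<close>

inductive smooth_fun :: "('a::euclidean_space \<Rightarrow> real) \<Rightarrow> bool" where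
  const: "smooth_fun (\<lambda>x. c)"
| linear: "bounded_linear f \<Longrightarrow> smooth_fun f"
| add: "smooth_fun f \<Longrightarrow> smooth_fun g \<Longrightarrow> smooth_fun (\<lambda>x. f x + g x)"
| mult: "smooth_fun f \<Longrightarrow> smooth_fun g \<Longrightarrow> smooth_fun (\<lambda>x. f x * g x)"
| comp: "(\<And>k s. (u k has_real_derivative u (Suc k) s) (at s)) \<Longrightarrow> smooth_fun f
    \<Longrightarrow> smooth_fun (\<lambda>x. u (0::nat) (f x))"
| primitive: "(\<And>x. (f has_derivative D x) (at x)) \<Longrightarrow> (\<And>b. smooth_fun (\<lambda>x. D x b)) \<Longrightarrow> smooth_fun f"

lemma smooth_fun_has_derivative:
  "smooth_fun f \<Longrightarrow> \<exists>D. (\<forall>x. (f has_derivative D x) (at x)) \<and> (\<forall>b. smooth_fun (\<lambda>x. D x b))"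
proof (induction rule: smooth_fun.induct)
  case (const c)
  show ?case by (intro exI[of _ "\<lambda>_ _. 0"]) (auto intro: smooth_fun.const)
next
  case (linear f)
  then show ?case
    by (intro exI[of _ "\<lambda>_. f"]) (auto intro: smooth_fun.const bounded_linear_imp_has_derivative)
next
  case (add f g)
  then obtain D E where "\<forall>x. (f has_derivative D x) (at x)" "\<forall>b. smooth_fun (\<lambda>x. D x b)"
    "\<forall>x. (g has_derivative E x) (at x)" "\<forall>b. smooth_fun (\<lambda>x. E x b)" by blast
  then show ?case
    by (intro exI[of _ "\<lambda>x b. D x b + E x b"])
      (auto intro!: smooth_fun.add has_derivative_add)
next
  case (mult f g)
  then obtain D E where "\<forall>x. (f has_derivative D x) (at x)" "\<forall>b. smooth_fun (\<lambda>x. D x b)"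
    "\<forall>x. (g has_derivative E x) (at x)" "\<forall>b. smooth_fun (\<lambda>x. E x b)" by blast
  with mult.hyps show ?case
    by (intro exI[of _ "\<lambda>x b. f x * E x b + D x b * g x"])
      (auto intro!: smooth_fun.add smooth_fun.mult has_derivative_mult)
next
  case (comp u f)
  then obtain D where D: "\<forall>x. (f has_derivative D x) (at x)" "\<forall>b. smooth_fun (\<lambda>x. D x b)"
    by blast
  have "((\<lambda>x. u 0 (f x)) has_derivative (\<lambda>b. u (Suc 0) (f x) * D x b)) (at x)" for x
    using has_derivative_compose[OF D(1)[rule_format] comp.hyps(1)[of 0, unfolded has_field_derivative_def]]
    by simp
  moreover have "smooth_fun (\<lambda>x. u (Suc 0) (f x))"
    using smooth_fun.comp[of "\<lambda>k. u (Suc k)", OF comp.hyps(1,2)] .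
  ultimately show ?case
    using D by (intro exI[of _ "\<lambda>x b. u (Suc 0) (f x) * D x b"]) (auto intro: smooth_fun.mult)
next
  case (primitive f D)
  then show ?case by blast
qed

lemma smooth_fun_frechet:
  assumes "smooth_fun f"
  shows "(f has_derivative frechet_derivative f (at x)) (at x)"
    and "smooth_fun (\<lambda>x. frechet_derivative f (at x) b)"
proof -
  obtain D where D: "\<And>x. (f has_derivative D x) (at x)" "\<And>b. smooth_fun (\<lambda>x. D x b)"
    using smooth_fun_has_derivative[OF assms] by blast
  have "frechet_derivative f (at x) = D x" for x
    using frechet_derivative_at[OF D(1)[of x]] by simp
  then show "(f has_derivative frechet_derivative f (at x)) (at x)"
    and "smooth_fun (\<lambda>x. frechet_derivative f (at x) b)" using D by auto
qed

lemma smooth_fun_differentiable: "smooth_fun f \<Longrightarrow> f differentiable (at x)"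
  using smooth_fun_frechet(1) differentiableI by blast

lemma smooth_fun_continuous_on: "smooth_fun f \<Longrightarrow> continuous_on S f"
  by (meson continuous_at_imp_continuous_on differentiable_imp_continuous_within smooth_fun_differentiable)

lemma smooth_fun_times_cont_diff: "smooth_fun f \<Longrightarrow> times_cont_diff k f"
  by (induction k arbitrary: f)
    (auto intro: smooth_fun_continuous_on smooth_fun_differentiable smooth_fun_frechet(2))

lemma smooth_fun_cmult: "smooth_fun f \<Longrightarrow> smooth_fun (\<lambda>x. c * f x)"
  by (intro smooth_fun.mult smooth_fun.const)

lemma smooth_fun_minus: "smooth_fun f \<Longrightarrow> smooth_fun (\<lambda>x. - f x)"
  using smooth_fun_cmult[of f "-1"] by simp

lemma smooth_fun_diff: "smooth_fun f \<Longrightarrow> smooth_fun g \<Longrightarrow> smooth_fun (\<lambda>x. f x - g x)"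
  using smooth_fun.add[OF _ smooth_fun_minus, of f g] by simp

lemma smooth_fun_power: "smooth_fun f \<Longrightarrow> smooth_fun (\<lambda>x. f x ^ m)"
  by (induction m) (auto intro: smooth_fun.const smooth_fun.mult)

lemma smooth_fun_sum: "(\<And>i. i \<in> I \<Longrightarrow> smooth_fun (f i)) \<Longrightarrow> smooth_fun (\<lambda>x. \<Sum>i\<in>I. f i x)"
  by (induction I rule: infinite_finite_induct) (auto intro: smooth_fun.const smooth_fun.add)

lemma smooth_fun_affine:
  assumes "smooth_fun f" and L: "bounded_linear L"
  shows "smooth_fun (\<lambda>x. f (c + L x))"
  using assms(1)
proof induction
  case (const a)
  show ?case by (rule smooth_fun.const)
next
  case (linear f)
  then have "(\<lambda>x. f (c + L x)) = (\<lambda>x. f c + f (L x))"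
    by (simp add: linear_add bounded_linear.linear)
  then show ?case
    using smooth_fun.add[OF smooth_fun.const smooth_fun.linear[OF bounded_linear_compose[OF linear L]], of "f c"]
    by simp
next
  case (add f g)
  then show ?case by (intro smooth_fun.add)
next
  case (mult f g)
  then show ?case by (intro smooth_fun.mult)
next
  case (comp u f)
  show ?case by (rule smooth_fun.comp[of u, OF comp.hyps(1) comp.IH])
next
  case (primitive f D)
  have "((\<lambda>x. c + L x) has_derivative L) (at x)" for x
    using has_derivative_add[OF has_derivative_const bounded_linear_imp_has_derivative[OF L]] by simp
  from has_derivative_compose[OF this primitive.hyps(1)]
  show ?case
    by (rule smooth_fun.primitive) (rule primitive.IH)
qed

text \<open>
  The functions \<open>q(1/x) exp(-1/x)\<close> with a polynomial \<open>q\<close>, continued by zero: differentiation only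
  changes \<open>q\<close>, so they contain all derivatives of \<open>exp(-1/x)\<close>.
\<close>

definition flat_exp :: "real poly \<Rightarrow> real \<Rightarrow> real" where
  "flat_exp q x = (if x > 0 then poly q (1 / x) * exp (- (1 / x)) else 0)"

lemma flat_exp_tendsto_0: "(flat_exp q \<longlongrightarrow> 0) (at 0)"
proof -
  have "((\<lambda>y. \<Sum>i\<le>degree q. coeff q i * (y ^ i / exp y)) \<longlongrightarrow> (\<Sum>i\<le>degree q. coeff q i * 0)) at_top"
    by (intro tendsto_sum tendsto_mult tendsto_const tendsto_power_div_exp_0)
  then have "((\<lambda>y. poly q y * exp (- y)) \<longlongrightarrow> 0) at_top"
    by (simp add: poly_altdef sum_distrib_right sum_divide_distrib exp_minus field_simps)
  then have "((\<lambda>x. poly q (1 / x) * exp (- (1 / x))) \<longlongrightarrow> 0) (at_right 0)"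
    by (rule filterlim_compose) (simp add: filterlim_inverse_at_top_right divide_inverse)
  then have "(flat_exp q \<longlongrightarrow> 0) (at_right 0)"
    by (rule Lim_transform_eventually) (auto simp: eventually_at_filter flat_exp_def)
  moreover have "(flat_exp q \<longlongrightarrow> 0) (at_left 0)"
    by (rule Lim_transform_eventually[OF tendsto_const]) (auto simp: eventually_at_filter flat_exp_def)
  ultimately show ?thesis
    using filterlim_split_at by blast
qed

lemma flat_exp_deriv:
  "(flat_exp q has_real_derivative flat_exp (monom 1 2 * (q - pderiv q)) x) (at x)"
proof -
  consider "x > 0" | "x < 0" | "x = 0" by linarith
  then show ?thesis
  proof cases
    case 1
    have "((\<lambda>x. poly q (1 / x) * exp (- (1 / x))) has_real_derivative
        flat_exp (monom 1 2 * (q - pderiv q)) x) (at x)"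
      using 1 by (auto intro!: derivative_eq_intros DERIV_chain2[OF poly_DERIV]
          simp: flat_exp_def poly_monom field_simps power2_eq_square)
    then show ?thesis
      by (rule has_field_derivative_transform_within_open[where S="{0<..}"])
        (use 1 in \<open>auto simp: flat_exp_def\<close>)
  next
    case 2
    have "((\<lambda>x. 0) has_real_derivative flat_exp (monom 1 2 * (q - pderiv q)) x) (at x)"
      using 2 by (simp add: flat_exp_def)
    then show ?thesis
      by (rule has_field_derivative_transform_within_open[where S="{..<0}"])
        (use 2 in \<open>auto simp: flat_exp_def\<close>)
  next
    case 3
    have "flat_exp q (0 + h) - flat_exp q 0 = h * flat_exp (pCons 0 q) h" for h
      by (simp add: flat_exp_def)
    then have "(\<lambda>h. (flat_exp q (0 + h) - flat_exp q 0) / h) = (\<lambda>h. if h = 0 then 0 else flat_exp (pCons 0 q) h)"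
      by auto
    moreover have "((\<lambda>h. if h = 0 then 0 else flat_exp (pCons 0 q) h) \<longlongrightarrow> 0) (at 0)"
      by (rule Lim_transform_eventually[OF flat_exp_tendsto_0[of "pCons 0 q"]])
        (auto simp: eventually_at_filter)
    ultimately show ?thesis
      using 3 unfolding DERIV_def by (simp add: flat_exp_def)
  qed
qed

lemma smooth_cutoff_exists:
  obtains g :: "nat \<Rightarrow> real \<Rightarrow> real"
  where "\<And>k x. (g k has_real_derivative g (Suc k) x) (at x)"
    and "\<And>k x. x \<le> 0 \<Longrightarrow> g k x = 0" and "\<And>x. x > 0 \<Longrightarrow> g 0 x > 0"
    and "mono (g 0)" and "g 0 1 = 1"
proof
  \<comment> \<open>The initial polynomial is the constant \<open>exp 1\<close>, which normalises the value at \<open>1\<close>.\<close>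
  let ?T = "\<lambda>q::real poly. monom 1 2 * (q - pderiv q)"
  define g where "g k = flat_exp ((?T ^^ k) [:exp 1:])" for k
  show "(g k has_real_derivative g (Suc k) x) (at x)" for k x
    unfolding g_def funpow.simps o_def by (rule flat_exp_deriv)
  show "g k x = 0" if "x \<le> 0" for k x
    using that by (simp add: g_def flat_exp_def)
  show "g 0 x > 0" if "x > 0" for x
    using that by (simp add: g_def flat_exp_def)
  show "mono (g 0)"
    by (auto simp: g_def flat_exp_def mono_def frac_le)
  show "g 0 1 = 1"
    by (simp add: g_def flat_exp_def exp_minus)
qed

section \<open>Calculus of the horizontal vector fields\<close>

text \<open>
  For uniform treatment, \<open>X_j\<close> and \<open>Y_j\<close> are indexed together by \<open>'n + 'n\<close>: the field with index
  \<open>i\<close> is \<open>\<partial>_i + drift i \<partial>_z\<close>.  The computations below rest on three facts: \<open>drift i\<close>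
  is annihilated by the field \<open>i\<close>, the vector of drifts is orthogonal to the horizontal position,
  and it has half its length.
\<close>

definition drift :: "'n::finite + 'n \<Rightarrow> 'n heis \<Rightarrow> real" where
  "drift i x = (case i of Inl j \<Rightarrow> - (x $ Some (Inr j)) / 2 | Inr j \<Rightarrow> x $ Some (Inl j) / 2)"

definition horizontal :: "'n::finite + 'n \<Rightarrow> 'n heis \<Rightarrow> 'n heis" where
  "horizontal i x = axis (Some i) 1 + drift i x *\<^sub>R axis None 1"

definition heis_D :: "'n::finite + 'n \<Rightarrow> ('n heis \<Rightarrow> real) \<Rightarrow> 'n heis \<Rightarrow> real" where
  "heis_D i f x = frechet_derivative f (at x) (horizontal i x)"

lemma horizontal_Some: "horizontal i x $ Some l = (if l = i then 1 else 0)"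
  by (simp add: horizontal_def axis_def)

lemma horizontal_None: "horizontal i x $ None = drift i x"
  by (simp add: horizontal_def axis_def)

lemma heis_D_eq: "(f has_derivative f') (at x) \<Longrightarrow> heis_D i f x = f' (horizontal i x)"
  unfolding heis_D_def using frechet_derivative_at by metis

lemma smooth_fun_coord: "smooth_fun (\<lambda>x::real^'m. x $ k)"
  by (intro smooth_fun.linear bounded_linear_vec_nth)

lemma bounded_linear_drift: "bounded_linear (drift i)"
proof (cases i)
  case (Inl j)
  have "drift i = (\<lambda>x. (- 1/2) *\<^sub>R (x $ Some (Inr j)))"
    by (auto simp: drift_def Inl)
  moreover have "bounded_linear (\<lambda>x::'a heis. (- 1/2) *\<^sub>R (x $ Some (Inr j)))"
    by (intro bounded_linear_const_scaleR bounded_linear_vec_nth)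
  ultimately show ?thesis by simp
next
  case (Inr j)
  have "drift i = (\<lambda>x. (1/2) *\<^sub>R (x $ Some (Inl j)))"
    by (auto simp: drift_def Inr)
  moreover have "bounded_linear (\<lambda>x::'a heis. (1/2) *\<^sub>R (x $ Some (Inl j)))"
    by (intro bounded_linear_const_scaleR bounded_linear_vec_nth)
  ultimately show ?thesis by simp
qed

lemma drift_horizontal: "drift i (horizontal i x) = 0"
  by (auto simp: drift_def horizontal_Some split: sum.split)

lemma sum_over_horizontal_indices:
  "(\<Sum>i\<in>(UNIV::('n::finite + 'n) set). f i) = (\<Sum>j\<in>UNIV. f (Inl j) + f (Inr j) :: real)"
  by (simp add: UNIV_Plus_UNIV[symmetric] sum.Plus sum.distrib del: UNIV_Plus_UNIV)

lemma heis_D_partial_deriv: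
  assumes "smooth_fun f"
  shows "heis_D i f x = partial_deriv (Some i) f x + drift i x * partial_deriv None f x"
proof -
  interpret bounded_linear "frechet_derivative f (at x)"
    using smooth_fun_frechet(1)[OF assms] by (rule has_derivative_bounded_linear)
  show ?thesis by (simp add: heis_D_def horizontal_def partial_deriv_def add scaleR)
qed

lemma smooth_heis_D:
  assumes "smooth_fun f" shows "smooth_fun (heis_D i f)"
proof -
  have "heis_D i f = (\<lambda>x. partial_deriv (Some i) f x + drift i x * partial_deriv None f x)"
    using heis_D_partial_deriv[OF assms] by auto
  then show ?thesis
    using smooth_fun_frechet(2)[OF assms] unfolding partial_deriv_def
    by (auto intro!: smooth_fun.add smooth_fun.mult smooth_fun.linear[OF bounded_linear_drift])
qed

lemma heis_X_eq: "smooth_fun f \<Longrightarrow> heis_X j f = heis_D (Inl j) f"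
  and heis_Y_eq: "smooth_fun f \<Longrightarrow> heis_Y j f = heis_D (Inr j) f"
  by (auto simp: heis_X_def heis_Y_def heis_D_partial_deriv drift_def)

lemma sub_laplacian_eq:
  "smooth_fun f \<Longrightarrow> sub_laplacian f x = - (\<Sum>i\<in>UNIV. heis_D i (heis_D i f) x)"
  by (simp add: sub_laplacian_def sum_over_horizontal_indices heis_X_eq heis_Y_eq smooth_heis_D)

lemma heis_D_mult:
  assumes "smooth_fun f" "smooth_fun g"
  shows "heis_D i (\<lambda>x. f x * g x) x = f x * heis_D i g x + heis_D i f x * g x"
  using heis_D_eq[OF has_derivative_mult[OF smooth_fun_frechet(1)[OF assms(1)] smooth_fun_frechet(1)[OF assms(2)]]]
  by (simp add: heis_D_def)

lemma heis_D_add: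
  assumes "smooth_fun f" "smooth_fun g"
  shows "heis_D i (\<lambda>x. f x + g x) x = heis_D i f x + heis_D i g x"
  using heis_D_eq[OF has_derivative_add[OF smooth_fun_frechet(1)[OF assms(1)] smooth_fun_frechet(1)[OF assms(2)]]]
  by (simp add: heis_D_def)

lemma heis_D_const: "heis_D i (\<lambda>x. c) x = 0"
  using heis_D_eq[OF has_derivative_const] .

lemma heis_D_cmult:
  assumes "smooth_fun f"
  shows "heis_D i (\<lambda>x. c * f x) x = c * heis_D i f x"
  using heis_D_mult[OF smooth_fun.const assms] by (simp add: heis_D_const)

lemma heis_D_compose:
  assumes "smooth_fun f" "(u has_real_derivative u') (at (f x))"
  shows "heis_D i (\<lambda>x. u (f x)) x = u' * heis_D i f x"
  using heis_D_eq[OF has_derivative_compose[OF smooth_fun_frechet(1)[OF assms(1)] assms(2)[unfolded has_field_derivative_def]]]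
  by (simp add: heis_D_def)

lemma heis_D_linear: "bounded_linear f \<Longrightarrow> heis_D i f x = f (horizontal i x)"
  using heis_D_eq[OF bounded_linear_imp_has_derivative] .

lemma heis_D_Some: "heis_D i (\<lambda>x. x $ Some l) x = (if l = i then 1 else 0)"
  by (simp add: heis_D_linear bounded_linear_vec_nth horizontal_Some)

lemma heis_D_None: "heis_D i (\<lambda>x. x $ None) x = drift i x"
  by (simp add: heis_D_linear bounded_linear_vec_nth horizontal_None)

lemma heis_D_drift: "heis_D i (drift i) x = 0"
  by (simp add: heis_D_linear bounded_linear_drift drift_horizontal)

lemma heis_D_power:
  assumes "smooth_fun f"
  shows "heis_D i (\<lambda>x. f x ^ m) x = real m * f x ^ (m - 1) * heis_D i f x"
  by (rule heis_D_compose[OF assms]) (auto intro!: derivative_eq_intros)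

text \<open>
  With the horizontal part \<open>hor_sq\<close>, the function \<open>heis_gauge\<close> is the fourth power of the Koranyi
  gauge.  The coefficient \<open>16\<close> is the one for which its squared horizontal gradient is a multiple of
  \<open>hor_sq * heis_gauge\<close>.
\<close>

definition hor_sq :: "'n::finite heis \<Rightarrow> real" where
  "hor_sq x = (\<Sum>l\<in>UNIV. (x $ Some l)\<^sup>2)"

definition heis_gauge :: "'n::finite heis \<Rightarrow> real" where
  "heis_gauge x = (hor_sq x)\<^sup>2 + 16 * (x $ None)\<^sup>2"

lemma smooth_hor_sq: "smooth_fun hor_sq"
  unfolding hor_sq_def by (intro smooth_fun_sum smooth_fun_power smooth_fun_coord)

lemma smooth_gauge: "smooth_fun heis_gauge"
  unfolding heis_gauge_def
  by (intro smooth_fun.add smooth_fun_cmult smooth_fun_power smooth_hor_sq smooth_fun_coord)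

lemma hor_sq_nonneg: "0 \<le> hor_sq x"
  by (simp add: hor_sq_def sum_nonneg)

lemma gauge_nonneg: "0 \<le> heis_gauge x"
  by (simp add: heis_gauge_def)

lemma hor_sq_coord_le: "(x $ Some l)\<^sup>2 \<le> hor_sq x"
  unfolding hor_sq_def by (rule member_le_sum) auto

lemma sum_drift_sq: "(\<Sum>i\<in>UNIV. (drift i x)\<^sup>2) = hor_sq x / 4"
  by (simp add: sum_over_horizontal_indices drift_def hor_sq_def power_divide sum.distrib add.commute add_divide_distrib flip: sum_divide_distrib)

lemma sum_coord_drift: "(\<Sum>i\<in>UNIV. x $ Some i * drift i x) = 0"
  by (simp add: sum_over_horizontal_indices drift_def)

lemma heis_D_hor_sq: "heis_D i hor_sq x = 2 * x $ Some i"
proof -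
  have "((\<lambda>x. (x $ Some l)\<^sup>2) has_derivative (\<lambda>v. 2 * x $ Some l * v $ Some l)) (at x)" for l
    using has_derivative_power[OF bounded_linear_imp_has_derivative[OF bounded_linear_vec_nth], of "Some l" 2 x UNIV]
    by (simp add: mult_ac)
  then have "(hor_sq has_derivative (\<lambda>v. \<Sum>l\<in>UNIV. 2 * x $ Some l * v $ Some l)) (at x)"
    unfolding hor_sq_def by (intro has_derivative_sum)
  then have "heis_D i hor_sq x = (\<Sum>l\<in>UNIV. 2 * x $ Some l * (if l = i then 1 else 0))"
    by (simp add: heis_D_eq horizontal_Some)
  then show ?thesis by (simp add: if_distrib cong: if_cong)
qed

lemma heis_D_gauge: "heis_D i heis_gauge x = 4 * hor_sq x * x $ Some i + 32 * x $ None * drift i x"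
proof -
  have "heis_D i heis_gauge x = heis_D i (\<lambda>x. (hor_sq x)\<^sup>2 + 16 * (x $ None)\<^sup>2) x"
    by (simp add: heis_gauge_def[abs_def])
  also have "\<dots> = 2 * hor_sq x * heis_D i hor_sq x + 16 * (2 * x $ None * drift i x)"
    by (simp add: heis_D_add heis_D_cmult heis_D_power heis_D_None
        smooth_fun_power smooth_fun_cmult smooth_hor_sq smooth_fun_coord)
  finally show ?thesis by (simp add: heis_D_hor_sq)
qed

lemma heis_D2_gauge:
  "heis_D i (heis_D i heis_gauge) x = 8 * (x $ Some i)\<^sup>2 + 4 * hor_sq x + 32 * (drift i x)\<^sup>2"
proof -
  have "heis_D i (heis_D i heis_gauge) x
      = heis_D i (\<lambda>x. 4 * (hor_sq x * x $ Some i) + 32 * (x $ None * drift i x)) x"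
    by (simp add: heis_D_gauge[abs_def] mult.assoc)
  also have "\<dots> = 4 * (hor_sq x + 2 * (x $ Some i)\<^sup>2) + 32 * (drift i x)\<^sup>2"
    by (simp add: heis_D_add heis_D_cmult heis_D_mult heis_D_None heis_D_Some heis_D_drift heis_D_hor_sq
        smooth_fun.mult smooth_fun_cmult smooth_hor_sq smooth_fun_coord
        smooth_fun.linear[OF bounded_linear_drift] power2_eq_square)
  finally show ?thesis by simp
qed

lemma laplacian_gauge:
  "(\<Sum>i\<in>UNIV. heis_D i (heis_D i heis_gauge) (x::'n::finite heis)) = (8 * real CARD('n) + 16) * hor_sq x"
proof -
  have "(\<Sum>i\<in>UNIV. heis_D i (heis_D i heis_gauge) x)
     = 8 * hor_sq x + real CARD('n + 'n) * (4 * hor_sq x) + 32 * (hor_sq x / 4)"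
    by (simp add: heis_D2_gauge sum.distrib sum_drift_sq hor_sq_def flip: sum_distrib_left)
  then show ?thesis by (simp add: algebra_simps)
qed

lemma gradient_gauge: "(\<Sum>i\<in>UNIV. (heis_D i heis_gauge x)\<^sup>2) = 16 * hor_sq x * heis_gauge x"
proof -
  have "(\<Sum>i\<in>UNIV. (heis_D i heis_gauge x)\<^sup>2)
      = (\<Sum>i\<in>UNIV. 16 * (hor_sq x)\<^sup>2 * (x $ Some i)\<^sup>2
          + 256 * hor_sq x * x $ None * (x $ Some i * drift i x) + 1024 * (x $ None)\<^sup>2 * (drift i x)\<^sup>2)"
    by (intro sum.cong) (auto simp: heis_D_gauge power2_eq_square algebra_simps)
  also have "\<dots> = 16 * (hor_sq x)\<^sup>2 * hor_sq x + 1024 * (x $ None)\<^sup>2 * (hor_sq x / 4)"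
    by (simp add: sum.distrib sum_drift_sq sum_coord_drift hor_sq_def[symmetric] flip: sum_distrib_left)
  finally show ?thesis
    by (simp add: heis_gauge_def power2_eq_square algebra_simps)
qed

text \<open>
  The product and chain rules.  Every error term carries a factor \<open>c\<close>, which will tend to zero.
  The cutoff is supported where \<open>c N \<le> 1\<close>, and there each \<open>c\<close> can be traded for \<open>1 / N\<close>;
  this is what makes the error terms bounded uniformly in \<open>c\<close>.
\<close>

lemma laplacian_cutoff:
  fixes p :: "'n::finite heis \<Rightarrow> real" and c :: real
  assumes g: "\<And>k s. (g k has_real_derivative g (Suc k) s) (at s)" and p: "smooth_fun p"
  defines "\<psi> \<equiv> \<lambda>x. p x * g 0 (1 - c * heis_gauge x)"
  shows "smooth_fun \<psi>"
    and "sub_laplacian \<psi> x = - (g 0 (1 - c * heis_gauge x) * (\<Sum>i\<in>UNIV. heis_D i (heis_D i p) x)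
           - 2 * c * g 1 (1 - c * heis_gauge x) * (\<Sum>i\<in>UNIV. heis_D i p x * heis_D i heis_gauge x)
           - c * p x * g 1 (1 - c * heis_gauge x) * ((8 * real CARD('n) + 16) * hor_sq x)
           + c\<^sup>2 * p x * g 2 (1 - c * heis_gauge x) * (16 * hor_sq x * heis_gauge x))"
proof -
  let ?s = "\<lambda>x. 1 - c * heis_gauge x"
  have s: "smooth_fun ?s"
    by (intro smooth_fun_diff smooth_fun.const smooth_fun_cmult smooth_gauge)
  have gs: "smooth_fun (\<lambda>x. g k (?s x))" for k
    using smooth_fun.comp[of "\<lambda>j. g (k + j)", OF _ s] g by simp
  show \<psi>: "smooth_fun \<psi>"
    unfolding \<psi>_def by (intro smooth_fun.mult p gs)
  have "?s = (\<lambda>x. 1 + (- c) * heis_gauge x)" by auto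
  then have Ds: "heis_D i ?s x = - c * heis_D i heis_gauge x" for i x
    using heis_D_add[OF smooth_fun.const smooth_fun_cmult[OF smooth_gauge], of i 1 "-c" x]
    unfolding heis_D_const heis_D_cmult[OF smooth_gauge] by simp
  have Dg: "heis_D i (\<lambda>x. g k (?s x)) x = - c * g (Suc k) (?s x) * heis_D i heis_gauge x" for i k x
    using heis_D_compose[OF s g, of i k x] by (simp add: Ds)
  have D2: "heis_D i (heis_D i \<psi>) x = g 0 (?s x) * heis_D i (heis_D i p) x
     - 2 * c * g 1 (?s x) * (heis_D i p x * heis_D i heis_gauge x)
     - c * p x * g 1 (?s x) * heis_D i (heis_D i heis_gauge) x
     + c\<^sup>2 * p x * g 2 (?s x) * (heis_D i heis_gauge x)\<^sup>2" for i
  proof -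
    let ?A = "\<lambda>x. p x * (g 1 (?s x) * heis_D i heis_gauge x)"
    let ?B = "\<lambda>x. heis_D i p x * g 0 (?s x)"
    note sm = smooth_fun.mult p gs smooth_heis_D smooth_gauge smooth_fun_cmult
    have "heis_D i \<psi> = (\<lambda>x. - c * ?A x + ?B x)"
      unfolding \<psi>_def by (rule ext) (simp add: heis_D_mult[OF p gs] Dg mult_ac)
    moreover have A: "smooth_fun ?A" and B: "smooth_fun ?B" by (intro sm)+
    ultimately have E1: "heis_D i (heis_D i \<psi>) x = - c * heis_D i ?A x + heis_D i ?B x"
      by (simp only: heis_D_add[OF smooth_fun_cmult[OF A] B] heis_D_cmult[OF A])
    have E2: "heis_D i ?A x = p x * (g 1 (?s x) * heis_D i (heis_D i heis_gauge) x
        - c * g 2 (?s x) * (heis_D i heis_gauge x)\<^sup>2) + heis_D i p x * (g 1 (?s x) * heis_D i heis_gauge x)"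
      using Dg[of i 1 x] by (simp add: heis_D_mult sm numeral_2_eq_2)
    have E3: "heis_D i ?B x = heis_D i p x * (- c * g 1 (?s x) * heis_D i heis_gauge x)
        + heis_D i (heis_D i p) x * g 0 (?s x)"
      using Dg[of i 0 x] by (simp add: heis_D_mult sm)
    show ?thesis
      unfolding E1 E2 E3 by (simp add: algebra_simps power2_eq_square)
  qed
  show "sub_laplacian \<psi> x = - (g 0 (?s x) * (\<Sum>i\<in>UNIV. heis_D i (heis_D i p) x)
           - 2 * c * g 1 (?s x) * (\<Sum>i\<in>UNIV. heis_D i p x * heis_D i heis_gauge x)
           - c * p x * g 1 (?s x) * ((8 * real CARD('n) + 16) * hor_sq x)
           + c\<^sup>2 * p x * g 2 (?s x) * (16 * hor_sq x * heis_gauge x))"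
    by (simp add: D2 sub_laplacian_eq[OF \<psi>] sum.distrib sum_subtractf laplacian_gauge[symmetric]
        gradient_gauge[symmetric] sum_distrib_left)
qed

lemma bounded_gauge_le: "bounded {x :: 'n::finite heis. heis_gauge x \<le> r}"
proof (rule boundedI)
  fix x :: "'n heis" assume "x \<in> {x. heis_gauge x \<le> r}"
  then have x: "(hor_sq x)\<^sup>2 + 16 * (x $ None)\<^sup>2 \<le> r"
    by (simp add: heis_gauge_def)
  have sq: "y \<le> 1 + y\<^sup>2" for y :: real
    using zero_le_power2[of "y - 1/2"] by (simp add: power2_eq_square algebra_simps)
  have "\<bar>x $ k\<bar> \<le> 2 + r" for k
  proof (cases k)
    case None
    have "\<bar>x $ None\<bar> \<le> 1 + (x $ None)\<^sup>2" using sq[of "\<bar>x $ None\<bar>"] by simp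
    then show ?thesis unfolding None using x zero_le_power2[of "hor_sq x"] zero_le_power2[of "x $ None"] by linarith
  next
    case (Some l)
    have "\<bar>x $ k\<bar> \<le> 1 + (x $ k)\<^sup>2" using sq[of "\<bar>x $ k\<bar>"] by simp
    also have "\<dots> \<le> 1 + hor_sq x" using hor_sq_coord_le Some by simp
    finally show ?thesis using sq[of "hor_sq x"] x zero_le_power2[of "x $ None"] by linarith
  qed
  then have "(\<Sum>k\<in>UNIV. \<bar>x $ k\<bar>) \<le> (\<Sum>k\<in>(UNIV::('n + 'n) option set). 2 + r)"
    by (intro sum_mono)
  then show "norm x \<le> (\<Sum>k\<in>(UNIV::('n + 'n) option set). 2 + r)"
    using norm_le_l1_cart[of x] by linarith
qed

section \<open>Test functions\<close>

definition test_fun :: "('a::euclidean_space \<Rightarrow> real) \<Rightarrow> bool" where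
  "test_fun f \<longleftrightarrow> smooth_fun f \<and> bounded {x. f x \<noteq> 0}"

lemma test_fun_imp_test_function: "test_fun f \<Longrightarrow> test_function f"
  by (simp add: test_fun_def test_function_def smooth_fun_times_cont_diff compact_closure)

lemma test_fun_bounded:
  assumes "test_fun f" obtains M where "\<And>x. \<bar>f x\<bar> \<le> M"
proof -
  let ?K = "closure {x. f x \<noteq> 0}"
  have "compact (f ` ?K)"
    using assms by (intro compact_continuous_image smooth_fun_continuous_on)
      (auto simp: test_fun_def compact_closure)
  then obtain M where "\<forall>y\<in>f ` ?K. norm y \<le> M"
    using compact_imp_bounded bounded_iff by blast
  then have "\<And>x. x \<in> ?K \<Longrightarrow> \<bar>f x\<bar> \<le> M" by auto
  moreover have "x \<in> ?K" if "f x \<noteq> 0" for x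
    using that closure_subset[of "{x. f x \<noteq> 0}"] by auto
  ultimately have "\<bar>f x\<bar> \<le> max M 0" for x
    by (cases "f x = 0") (auto simp: le_max_iff_disj)
  then show ?thesis by (rule that)
qed

lemma test_fun_heis_D:
  assumes "test_fun f" shows "test_fun (heis_D i f)"
proof -
  let ?K = "closure {x. f x \<noteq> 0}"
  have "heis_D i f x = 0" if "x \<notin> ?K" for x
  proof -
    have "(f has_derivative (\<lambda>_. 0)) (at x)"
    proof (rule has_derivative_transform_within_open[OF has_derivative_const])
      show "open (- ?K)" by auto
      show "0 = f y" if "y \<in> - ?K" for y
        using that closure_subset[of "{x. f x \<noteq> 0}"] by auto
    qed (use that in auto)
    then show ?thesis by (simp add: heis_D_eq)
  qed
  then have "{x. heis_D i f x \<noteq> 0} \<subseteq> ?K" by auto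
  then have "bounded {x. heis_D i f x \<noteq> 0}"
    by (rule bounded_subset[rotated]) (use assms in \<open>auto simp: test_fun_def\<close>)
  with assms show ?thesis
    by (simp add: test_fun_def smooth_heis_D)
qed

lemma test_fun_sub_laplacian:
  assumes "test_fun f" shows "test_fun (sub_laplacian f)"
proof -
  have f: "smooth_fun f" using assms by (simp add: test_fun_def)
  have D: "test_fun (heis_D i (heis_D i f))" for i
    using assms by (intro test_fun_heis_D)
  have "{x. sub_laplacian f x \<noteq> 0} \<subseteq> (\<Union>i\<in>UNIV. {x. heis_D i (heis_D i f) x \<noteq> 0})"
  proof (intro subsetI, rule ccontr)
    fix x assume "x \<in> {x. sub_laplacian f x \<noteq> 0}" "x \<notin> (\<Union>i\<in>UNIV. {x. heis_D i (heis_D i f) x \<noteq> 0})"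
    then show False by (simp add: sub_laplacian_eq[OF f])
  qed
  then have "bounded {x. sub_laplacian f x \<noteq> 0}"
    by (rule bounded_subset[rotated]) (use D in \<open>auto simp: test_fun_def\<close>)
  moreover have "smooth_fun (\<lambda>x. - (\<Sum>i\<in>UNIV. heis_D i (heis_D i f) x))"
    by (intro smooth_fun_minus smooth_fun_sum smooth_heis_D f)
  moreover have "sub_laplacian f = (\<lambda>x. - (\<Sum>i\<in>UNIV. heis_D i (heis_D i f) x))"
    by (rule ext) (rule sub_laplacian_eq[OF f])
  ultimately show ?thesis by (simp add: test_fun_def)
qed

lemma smooth_fun_measurable: "smooth_fun f \<Longrightarrow> f \<in> borel_measurable borel"
  by (intro borel_measurable_continuous_onI smooth_fun_continuous_on)

lemma test_fun_measurable: "test_fun f \<Longrightarrow> f \<in> borel_measurable borel"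
  by (simp add: test_fun_def smooth_fun_measurable)

lemma sub_laplacian_cmult:
  assumes "smooth_fun f" shows "sub_laplacian (\<lambda>x. c * f x) x = c * sub_laplacian f x"
proof -
  have "heis_D i (\<lambda>x. c * f x) = (\<lambda>x. c * heis_D i f x)" for i
    using heis_D_cmult[OF assms] by auto
  then show ?thesis
    by (simp add: sub_laplacian_eq assms smooth_fun_cmult heis_D_cmult smooth_heis_D sum_distrib_left)
qed

lemma heat_transpose_product:
  assumes "smooth_fun \<psi>" "(\<eta> has_real_derivative \<eta>') (at t)"
  shows "heat_transpose (\<lambda>(t, x). \<eta> t * \<psi> x) (t, x) = \<eta> t * sub_laplacian \<psi> x - \<eta>' * \<psi> x"
proof -
  have "((\<lambda>s. \<eta> s * \<psi> x) has_real_derivative \<eta>' * \<psi> x) (at t)"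
    by (rule DERIV_cmult_right[OF assms(2)])
  then have "deriv (\<lambda>s. \<eta> s * \<psi> x) t = \<eta>' * \<psi> x" by (rule DERIV_imp_deriv)
  then show ?thesis by (simp add: heat_transpose_def sub_laplacian_cmult[OF assms(1)])
qed

lemma test_fun_product:
  assumes "test_fun \<eta>" "test_fun \<psi>"
  shows "test_fun (\<lambda>(t, x). \<eta> t * \<psi> x)"
proof -
  have "smooth_fun (\<lambda>z. \<eta> (fst z) * \<psi> (snd z))"
    using smooth_fun_affine[OF _ bounded_linear_fst, of \<eta> 0]
      smooth_fun_affine[OF _ bounded_linear_snd, of \<psi> 0] assms
    by (intro smooth_fun.mult) (simp_all add: test_fun_def)
  moreover have "{z. \<eta> (fst z) * \<psi> (snd z) \<noteq> 0} \<subseteq> {t. \<eta> t \<noteq> 0} \<times> {x. \<psi> x \<noteq> 0}"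
    by auto
  then have "bounded {z. \<eta> (fst z) * \<psi> (snd z) \<noteq> 0}"
    by (rule bounded_subset[rotated]) (use assms in \<open>auto simp: test_fun_def intro!: bounded_Times\<close>)
  ultimately show ?thesis by (simp add: test_fun_def case_prod_unfold)
qed

text \<open>
  A window in time that opens before time \<open>0\<close>, where the heat kernel vanishes, and closes around
  \<open>t0\<close>.  With an antiderivative \<open>P\<close> of an even bump of radius \<open>\<epsilon>\<close>, the function
  \<open>P (s + t0) - P (s - t0)\<close> does this: \<open>P\<close> is constant on both sides of the bump, so the two
  terms cancel for large \<open>\<bar>s\<bar>\<close>, and on positive times the derivative is just the bump
  centred at \<open>t0\<close>, with a minus sign.
\<close>

lemma time_window:
  fixes \<epsilon> t0 :: real
  assumes \<epsilon>: "0 < \<epsilon>" "\<epsilon> < t0"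
  obtains \<eta> \<eta>' where "test_fun \<eta>" "smooth_fun \<eta>'" "\<And>s. (\<eta> has_real_derivative \<eta>' s) (at s)"
    and "\<And>s. 0 \<le> s \<Longrightarrow> \<eta>' s \<le> 0" and "\<eta>' t0 < 0"
    and "\<And>s. 0 \<le> s \<Longrightarrow> \<epsilon> \<le> \<bar>s - t0\<bar> \<Longrightarrow> \<eta>' s = 0" and "\<And>s. t0 + \<epsilon> \<le> s \<Longrightarrow> \<eta> s = 0"
proof -
  obtain g :: "nat \<Rightarrow> real \<Rightarrow> real" where g: "\<And>k x. (g k has_real_derivative g (Suc k) x) (at x)"
    "\<And>k x. x \<le> 0 \<Longrightarrow> g k x = 0" "\<And>x. x > 0 \<Longrightarrow> g 0 x > 0" "mono (g 0)" "g 0 1 = 1"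
    by (rule smooth_cutoff_exists, rule that)
  define \<beta> where "\<beta> s = g 0 (\<epsilon>\<^sup>2 - s\<^sup>2)" for s
  have s\<beta>: "smooth_fun \<beta>"
    unfolding \<beta>_def
    by (intro smooth_fun.comp[of g] g smooth_fun_diff smooth_fun.const smooth_fun_power
        smooth_fun.linear[OF bounded_linear_ident])
  have \<beta>0: "\<beta> s = 0" if "\<epsilon> \<le> \<bar>s\<bar>" for s
    unfolding \<beta>_def using that \<epsilon> abs_le_square_iff[of \<epsilon> s] by (intro g(2)) auto
  have \<beta>nn: "0 \<le> \<beta> s" for s
    unfolding \<beta>_def using g(2,3) by (metis less_eq_real_def not_le)
  have \<beta>pos: "0 < \<beta> 0" unfolding \<beta>_def using \<epsilon> by (intro g(3)) auto
  have c\<beta>: "continuous_on S \<beta>" for S using s\<beta> by (rule smooth_fun_continuous_on)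
  obtain P where P: "\<And>s. (P has_real_derivative \<beta> s) (at s)"
    using einterval_antiderivative[of "-\<infinity>" "\<infinity>" \<beta>] c\<beta>[of UNIV]
    by (auto simp: continuous_on_eq_continuous_at has_real_derivative_iff_has_vector_derivative)
  have Pdiff: "P b - P a = integral {a..b} \<beta>" if "a \<le> b" for a b
  proof -
    have "(\<beta> has_integral P b - P a) {a..b}"
      using P by (intro fundamental_theorem_of_calculus[OF that])
        (simp add: has_real_derivative_iff_has_vector_derivative has_vector_derivative_at_within)
    then show ?thesis by (simp add: integral_unique)
  qed
  have Plow: "P s = P (- \<epsilon>)" if "s \<le> - \<epsilon>" for s
  proof -
    have "integral {s..- \<epsilon>} \<beta> = integral {s..- \<epsilon>} (\<lambda>_. 0)"
      using \<epsilon> by (intro integral_cong \<beta>0) auto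
    then show ?thesis using Pdiff[OF that] by simp
  qed
  have Phigh: "P s = P \<epsilon>" if "\<epsilon> \<le> s" for s
  proof -
    have "integral {\<epsilon>..s} \<beta> = integral {\<epsilon>..s} (\<lambda>_. 0)"
      using \<epsilon> by (intro integral_cong \<beta>0) auto
    then show ?thesis using Pdiff[OF that] by simp
  qed
  define \<eta> \<eta>' where "\<eta> s = P (s + t0) - P (s - t0)" and "\<eta>' s = \<beta> (s + t0) - \<beta> (s - t0)" for s
  have \<eta>': "(\<eta> has_real_derivative \<eta>' s) (at s)" for s
    unfolding \<eta>_def \<eta>'_def
    by (rule derivative_eq_intros DERIV_chain2[OF P] refl | simp)+
  have s\<eta>': "smooth_fun \<eta>'"
    unfolding \<eta>'_def
    using smooth_fun_diff[OF smooth_fun_affine[OF s\<beta> bounded_linear_ident, of t0]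
      smooth_fun_affine[OF s\<beta> bounded_linear_ident, of "- t0"]] by (simp add: add.commute)
  have "smooth_fun \<eta>"
  proof (rule smooth_fun.primitive)
    show "(\<eta> has_derivative (\<lambda>b. \<eta>' s * b)) (at s)" for s
      using \<eta>'[of s] by (simp add: has_field_derivative_def)
    show "smooth_fun (\<lambda>s. \<eta>' s * b)" for b by (intro smooth_fun.mult s\<eta>' smooth_fun.const)
  qed
  moreover have "\<eta> s = 0" if "s \<notin> {- (t0 + \<epsilon>)..t0 + \<epsilon>}" for s
  proof (cases "s < 0")
    case True
    with that \<epsilon> show ?thesis using Plow[of "s + t0"] Plow[of "s - t0"] by (auto simp: \<eta>_def)
  next
    case False
    with that \<epsilon> show ?thesis using Phigh[of "s + t0"] Phigh[of "s - t0"] by (auto simp: \<eta>_def)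
  qed
  then have "{s. \<eta> s \<noteq> 0} \<subseteq> {- (t0 + \<epsilon>)..t0 + \<epsilon>}" by blast
  then have "bounded {s. \<eta> s \<noteq> 0}" by (rule bounded_subset[rotated]) simp
  ultimately have \<eta>: "test_fun \<eta>" by (simp add: test_fun_def)
  have \<eta>'pos: "\<eta>' s = - \<beta> (s - t0)" if "0 \<le> s" for s
    unfolding \<eta>'_def using \<beta>0[of "s + t0"] that \<epsilon> by auto
  show ?thesis
  proof (rule that[OF \<eta> s\<eta>' \<eta>'])
    show "\<eta> s = 0" if "t0 + \<epsilon> \<le> s" for s
      using that \<epsilon> Phigh[of "s + t0"] Phigh[of "s - t0"] by (simp add: \<eta>_def)
  qed (use \<epsilon> \<beta>nn \<beta>pos \<beta>0 \<eta>'pos in auto)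
qed

section \<open>The heat equation for means of test functions\<close>

locale heisenberg_heat =
  fixes h :: "real \<Rightarrow> 'n::finite heis \<Rightarrow> real"
  assumes h: "heat_kernel h"
begin

lemma h_nonneg: "0 \<le> h t x" and h_nonpos_time: "t \<le> 0 \<Longrightarrow> h t x = 0"
  and h_mass: "t > 0 \<Longrightarrow> (LINT x|lborel. h t x) = 1"
  using h by (auto simp: heat_kernel_def)

lemma h_continuous: "continuous_on ({0<..} \<times> UNIV) (\<lambda>(t, x). h t x)"
  using h by (simp add: heat_kernel_def)

lemma h_measurable2: "(\<lambda>(t, x). h t x) \<in> borel_measurable borel"
proof -
  have "(\<lambda>z. indicator ({0<..} \<times> UNIV) z *\<^sub>R (case z of (t, x) \<Rightarrow> h t x)) \<in> borel_measurable borel"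
    by (rule borel_measurable_continuous_on_indicator[OF _ h_continuous])
      (auto intro!: borel_open open_Times)
  moreover have "(\<lambda>z. indicator ({0<..} \<times> UNIV) z *\<^sub>R (case z of (t, x) \<Rightarrow> h t x)) = (\<lambda>(t, x). h t x)"
    by (auto simp: fun_eq_iff indicator_def h_nonpos_time)
  ultimately show ?thesis by simp
qed

lemma h_measurable_pair[measurable]: "(\<lambda>(t, x). h t x) \<in> borel_measurable (lborel \<Otimes>\<^sub>M lborel)"
  using h_measurable2 by (simp add: lborel_prod)

lemma h_measurable[measurable]: "h t \<in> borel_measurable borel"
  using measurable_compose[OF measurable_Pair1' h_measurable_pair, of t] by simp

lemma h_integrable: "integrable lborel (h t)"
proof (cases "t > 0")
  case True
  then show ?thesis using h_mass[of t] not_integrable_integral_eq by fastforce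
next
  case False
  then have "h t = (\<lambda>x. 0)" using h_nonpos_time by auto
  then show ?thesis by simp
qed

lemma h_mass_le: "(LINT x|lborel. h t x) \<le> 1"
  by (cases "t > 0") (auto simp: h_mass h_nonpos_time)

lemma integrable_bounded_h:
  assumes [measurable]: "f \<in> borel_measurable borel" and M: "\<And>x. \<bar>f x\<bar> \<le> M"
  shows "integrable lborel (\<lambda>x. f x * h t x)" and "\<bar>LINT x|lborel. f x * h t x\<bar> \<le> M"
proof -
  have b: "\<bar>f x * h t x\<bar> \<le> M * h t x" for x
    using M h_nonneg[of t x] by (simp add: abs_mult mult_right_mono)
  have 0: "0 \<le> M" using M[of undefined] by linarith
  have i: "integrable lborel (\<lambda>x. M * h t x)" using h_integrable by simp
  show int: "integrable lborel (\<lambda>x. f x * h t x)"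
    by (rule Bochner_Integration.integrable_bound[OF i]) (use b 0 h_nonneg in \<open>auto simp: abs_mult\<close>)
  have "\<bar>LINT x|lborel. f x * h t x\<bar> \<le> (LINT x|lborel. M * h t x)"
    using Bochner_Integration.integral_norm_bound_integral[OF int i] b by simp
  also have "\<dots> \<le> M" using mult_left_mono[OF h_mass_le 0, of t] by simp
  finally show "\<bar>LINT x|lborel. f x * h t x\<bar> \<le> M" .
qed

definition mean :: "('n heis \<Rightarrow> real) \<Rightarrow> real \<Rightarrow> real" where
  "mean f t = (LINT x|lborel. f x * h t x)"

lemma mean_nonpos_time: "t \<le> 0 \<Longrightarrow> mean f t = 0"
  by (simp add: mean_def h_nonpos_time)

lemma mean_measurable[measurable]:
  assumes [measurable]: "f \<in> borel_measurable borel"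
  shows "mean f \<in> borel_measurable borel"
proof -
  have "(\<lambda>z. f (snd z) * (case z of (t, x) \<Rightarrow> h t x)) \<in> borel_measurable (lborel \<Otimes>\<^sub>M lborel)"
    by measurable
  then have "(\<lambda>(t, x). f x * h t x) \<in> borel_measurable (lborel \<Otimes>\<^sub>M lborel)"
    by (simp only: case_prod_unfold)
  from lborel.borel_measurable_lebesgue_integral[OF this] show ?thesis
    by (simp add: mean_def[abs_def])
qed

lemma mean_bound:
  assumes "f \<in> borel_measurable borel" and "\<And>x. \<bar>f x\<bar> \<le> M"
  shows "\<bar>mean f t\<bar> \<le> M"
  unfolding mean_def using assms by (rule integrable_bounded_h)

text \<open>
  The distributional equation on product test functions, with the space integral carried out.
  Local integrability of \<open>h\<close> is what allows this integral to be taken first.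
\<close>

lemma weak_heat_equation:
  assumes \<psi>: "test_fun \<psi>" and \<eta>: "test_fun \<eta>"
    and \<eta>': "\<And>t. (\<eta> has_real_derivative \<eta>' t) (at t)"
    and c': "continuous_on UNIV \<eta>'"
  shows "integrable lborel (\<lambda>t. \<eta> t * mean (sub_laplacian \<psi>) t - \<eta>' t * mean \<psi> t)"
    and "(LINT t|lborel. \<eta> t * mean (sub_laplacian \<psi>) t - \<eta>' t * mean \<psi> t) = \<eta> 0 * \<psi> 0"
proof -
  let ?\<phi> = "\<lambda>(t, x). \<eta> t * \<psi> x"
  let ?L = "sub_laplacian \<psi>"
  define K where "K = closure {t. \<eta> t \<noteq> 0} \<times> closure ({x. \<psi> x \<noteq> 0} \<union> {x. sub_laplacian \<psi> x \<noteq> 0})"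
  let ?F = "\<lambda>(t, x). h t x * heat_transpose ?\<phi> (t, x)"
  note L = test_fun_sub_laplacian[OF \<psi>]
  have s\<psi>: "smooth_fun \<psi>" using \<psi> by (simp add: test_fun_def)
  have ht: "heat_transpose ?\<phi> (t, x) = \<eta> t * ?L x - \<eta>' t * \<psi> x" for t x
    by (rule heat_transpose_product[OF s\<psi> \<eta>'])
  have [measurable]: "\<psi> \<in> borel_measurable borel" "?L \<in> borel_measurable borel" "\<eta> \<in> borel_measurable borel"
    "\<eta>' \<in> borel_measurable borel"
    using \<psi> L \<eta> c' by (auto intro: test_fun_measurable borel_measurable_continuous_onI)
  have K: "compact K"
    using \<psi> L \<eta> unfolding K_def by (auto simp: test_fun_def compact_closure closure_Un intro!: compact_Times compact_Un)
  have z\<eta>: "\<eta> t = 0" "\<eta>' t = 0" if "t \<notin> closure {t. \<eta> t \<noteq> 0}" for t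
  proof -
    show "\<eta> t = 0" using that closure_subset[of "{t. \<eta> t \<noteq> 0}"] by auto
    have "(\<eta> has_real_derivative 0) (at t)"
    proof (rule has_field_derivative_transform_within_open[OF DERIV_const])
      show "open (- closure {t. \<eta> t \<noteq> 0})" by auto
      show "0 = \<eta> y" if "y \<in> - closure {t. \<eta> t \<noteq> 0}" for y
        using that closure_subset[of "{t. \<eta> t \<noteq> 0}"] by auto
    qed (use that in auto)
    then show "\<eta>' t = 0" using DERIV_unique \<eta>' by blast
  qed
  have ht0: "\<eta> t * ?L x - \<eta>' t * \<psi> x = 0" if "(t, x) \<notin> K" for t x
  proof (cases "t \<in> closure {t. \<eta> t \<noteq> 0}")
    case True
    with that[unfolded K_def] have "x \<notin> {x. \<psi> x \<noteq> 0} \<union> {x. ?L x \<noteq> 0}"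
      using closure_subset[of "{x. \<psi> x \<noteq> 0} \<union> {x. ?L x \<noteq> 0}"] by blast
    then show ?thesis by simp
  next
    case False
    from z\<eta>[OF False] show ?thesis by simp
  qed
  define H where "H = (\<lambda>z. \<eta> (fst z) * ?L (snd z) - \<eta>' (fst z) * \<psi> (snd z))"
  have c: "continuous_on UNIV \<eta>" "continuous_on UNIV \<psi>" "continuous_on UNIV ?L"
    using \<psi> L \<eta> unfolding test_fun_def by (blast intro: smooth_fun_continuous_on)+
  have Hcont: "continuous_on UNIV H"
    using continuous_on_compose2[OF c(1) continuous_on_fst[OF continuous_on_id]]
      continuous_on_compose2[OF c' continuous_on_fst[OF continuous_on_id]]
      continuous_on_compose2[OF c(2) continuous_on_snd[OF continuous_on_id]]
      continuous_on_compose2[OF c(3) continuous_on_snd[OF continuous_on_id]]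
    unfolding H_def by (intro continuous_on_diff continuous_on_mult) auto
  then have "compact (H ` K)"
    by (rule compact_continuous_image[OF continuous_on_subset K]) simp
  then obtain C where C: "\<forall>y\<in>H ` K. norm y \<le> C"
    using compact_imp_bounded bounded_iff by blast
  have HC: "\<bar>H z\<bar> \<le> C" if "z \<in> K" for z
    using C that by auto
  have Feq: "?F = (\<lambda>z. (case z of (t, x) \<Rightarrow> h t x) * H z)"
  proof
    fix z show "?F z = (case z of (t, x) \<Rightarrow> h t x) * H z"
      by (cases z) (simp only: prod.case ht H_def fst_conv snd_conv)
  qed
  have "integrable lborel (\<lambda>z. indicator K z *\<^sub>R (case z of (t, x) \<Rightarrow> h t x))"
    using h K by (auto simp: heat_kernel_def fundamental_solution_def locally_integrable_def set_integrable_def)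
  then have dom: "integrable lborel (\<lambda>z. C * (indicator K z *\<^sub>R (case z of (t, x) \<Rightarrow> h t x)))"
    by (rule integrable_mult_right)
  have meas: "?F \<in> borel_measurable borel"
    unfolding Feq using h_measurable2 borel_measurable_continuous_onI[OF Hcont]
    by (rule borel_measurable_times)
  have F: "integrable lborel ?F"
  proof (rule Bochner_Integration.integrable_bound[OF dom])
    show "?F \<in> borel_measurable lborel" using meas by simp
    have "norm (?F z) \<le> norm (C * (indicator K z *\<^sub>R (case z of (t, x) \<Rightarrow> h t x)))" for z
    proof (cases "z \<in> K")
      case True
      have "\<bar>H z\<bar> * h (fst z) (snd z) \<le> \<bar>C\<bar> * h (fst z) (snd z)"
        using HC[OF True] by (intro mult_right_mono h_nonneg) auto
      with True show ?thesis
        by (simp only: Feq) (simp add: case_prod_unfold abs_mult h_nonneg mult.commute)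
    next
      case False
      then have "H z = 0" using ht0[of "fst z" "snd z"] by (simp add: H_def)
      then show ?thesis by (simp only: Feq) simp
    qed
    then show "AE z in lborel. norm (?F z) \<le> norm (C * (indicator K z *\<^sub>R (case z of (t, x) \<Rightarrow> h t x)))"
      by simp
  qed
  then have F': "integrable (lborel \<Otimes>\<^sub>M lborel) ?F" by (simp add: lborel_prod)
  obtain M1 where M1: "\<And>x. \<bar>\<psi> x\<bar> \<le> M1" using test_fun_bounded[OF \<psi>] by blast
  obtain M2 where M2: "\<And>x. \<bar>?L x\<bar> \<le> M2" using test_fun_bounded[OF L] by blast
  have int: "integrable lborel (\<lambda>x. \<psi> x * h t x)" "integrable lborel (\<lambda>x. ?L x * h t x)" for t
    using integrable_bounded_h(1)[of \<psi> M1 t] integrable_bounded_h(1)[of ?L M2 t] M1 M2 by simp_all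
  have inner: "(LINT x|lborel. ?F (t, x)) = \<eta> t * mean ?L t - \<eta>' t * mean \<psi> t" for t
  proof -
    have "(LINT x|lborel. ?F (t, x)) = (LINT x|lborel. \<eta> t * (?L x * h t x) - \<eta>' t * (\<psi> x * h t x))"
      by (simp add: ht algebra_simps)
    also have "\<dots> = \<eta> t * mean ?L t - \<eta>' t * mean \<psi> t"
      using int by (simp add: mean_def)
    finally show ?thesis .
  qed
  show "integrable lborel (\<lambda>t. \<eta> t * mean ?L t - \<eta>' t * mean \<psi> t)"
    using lborel_pair.integrable_fst'[OF F'] by (simp only: inner)
  have "(LINT t|lborel. \<eta> t * mean ?L t - \<eta>' t * mean \<psi> t) = integral\<^sup>L lborel ?F"
    using lborel_pair.integral_fst'[OF F'] by (simp only: inner lborel_prod)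
  also have "\<dots> = \<eta> 0 * \<psi> 0"
    using h test_fun_imp_test_function[OF test_fun_product[OF \<eta> \<psi>]]
    by (auto simp: heat_kernel_def fundamental_solution_def)
  finally show "(LINT t|lborel. \<eta> t * mean ?L t - \<eta>' t * mean \<psi> t) = \<eta> 0 * \<psi> 0" .
qed

text \<open>
  On a compact time interval away from \<open>0\<close> and on the support of \<open>\<psi>\<close>, continuity bounds \<open>h\<close>, so
  dominated convergence applies.
\<close>

lemma mean_continuous:
  assumes \<psi>: "test_fun \<psi>" and a: "0 < a"
  shows "continuous_on {a..b} (mean \<psi>)"
proof -
  let ?K = "closure {x. \<psi> x \<noteq> 0}"
  have K: "compact ?K" using \<psi> by (simp add: test_fun_def compact_closure)
  obtain M where M: "\<And>x. \<bar>\<psi> x\<bar> \<le> M" using test_fun_bounded[OF \<psi>] by blast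
  have [measurable]: "\<psi> \<in> borel_measurable borel" using test_fun_measurable[OF \<psi>] .
  have sub: "{a..b} \<times> ?K \<subseteq> {0<..} \<times> UNIV" using a by auto
  have "compact ((\<lambda>(t, x). h t x) ` ({a..b} \<times> ?K))"
    using K by (intro compact_continuous_image continuous_on_subset[OF h_continuous sub] compact_Times) auto
  then obtain C where C: "\<forall>y\<in>(\<lambda>(t, x). h t x) ` ({a..b} \<times> ?K). norm y \<le> C"
    using compact_imp_bounded bounded_iff by blast
  have dom: "integrable lborel (\<lambda>x. M * C * indicator ?K x)"
    using emeasure_compact_finite[OF K] K by (simp add: compact_imp_closed)
  show ?thesis
    unfolding continuous_on_sequentially comp_def
  proof (intro allI ballI impI, elim conjE)
    fix s t assume t: "t \<in> {a..b}" and s: "\<forall>n. s n \<in> {a..b}" "s \<longlonglongrightarrow> t"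
    have lim: "(\<lambda>n. \<psi> x * h (s n) x) \<longlonglongrightarrow> \<psi> x * h t x" for x
    proof -
      have "isCont (\<lambda>(t, x). h t x) (t, x)"
        using h_continuous t a by (subst (asm) continuous_on_eq_continuous_at) (auto intro!: open_Times)
      moreover have "(\<lambda>n. (s n, x)) \<longlonglongrightarrow> (t, x)" by (intro tendsto_intros s)
      ultimately have "(\<lambda>n. h (s n) x) \<longlonglongrightarrow> h t x"
        using isCont_tendsto_compose[of "(t, x)" "\<lambda>(t, x). h t x" "\<lambda>n. (s n, x)"] by simp
      then show ?thesis by (intro tendsto_intros)
    qed
    have bound: "norm (\<psi> x * h (s n) x) \<le> M * C * indicator ?K x" for n x
    proof (cases "x \<in> ?K")
      case True
      have "norm (h (s n) x) \<le> C" using C s(1) True by force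
      then have "\<bar>\<psi> x\<bar> * \<bar>h (s n) x\<bar> \<le> M * C"
        using M[of x] by (intro mult_mono) auto
      with True show ?thesis by (simp add: abs_mult)
    next
      case False
      then have "\<psi> x = 0" using closure_subset[of "{x. \<psi> x \<noteq> 0}"] by auto
      with False show ?thesis by simp
    qed
    show "(\<lambda>n. mean \<psi> (s n)) \<longlonglongrightarrow> mean \<psi> t"
      unfolding mean_def
      by (rule integral_dominated_convergence[OF _ _ dom]) (use lim bound in auto)
  qed
qed


lemma mean_integrable_on:
  assumes [measurable]: "f \<in> borel_measurable borel" and M: "\<And>x. \<bar>f x\<bar> \<le> M"
  shows "mean f integrable_on {a..b}"
proof -
  have "set_integrable lborel {a..b} (mean f)"
    unfolding set_integrable_def
  proof (rule Bochner_Integration.integrable_bound)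
    show "integrable lborel (\<lambda>s. M * indicator {a..b} s)"
      by (intro integrable_mult_right integrable_real_indicator) (auto simp: emeasure_lborel_Icc_eq)
    show "AE s in lborel. norm (indicator {a..b} s *\<^sub>R mean f s) \<le> norm (M * indicator {a..b} s)"
      using mean_bound[OF assms]
      by (auto simp: indicator_def intro!: AE_I2 order_trans[OF _ abs_ge_self])
  qed simp
  then show ?thesis by (rule set_borel_integral_eq_integral(1))
qed

text \<open>
  Let \<open>u\<close> be the difference of the two sides as a function of time.  An integration by parts turns
  the weak equation into \<open>\<integral> \<eta>' u = 0\<close> over positive times for every time window \<open>\<eta>\<close>.  If \<open>u t0\<close>
  were nonzero, then \<open>u\<close> would have constant sign near \<open>t0\<close> by continuity, and a narrow window closing
  there would make this integral nonzero.
\<close>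

lemma duhamel:
  assumes \<psi>: "test_fun \<psi>" and t0: "0 < t0"
  shows "mean \<psi> t0 = \<psi> 0 - integral {0..t0} (mean (sub_laplacian \<psi>))"
proof (rule ccontr)
  let ?G = "mean (sub_laplacian \<psi>)"
  define I where "I s = integral {0..s} ?G" for s
  define u where "u s = mean \<psi> s - \<psi> 0 + I s" for s
  assume "\<not> ?thesis"
  then have u0: "u t0 \<noteq> 0" by (simp add: u_def I_def)
  note L = test_fun_sub_laplacian[OF \<psi>]
  obtain M where M: "\<And>x. \<bar>sub_laplacian \<psi> x\<bar> \<le> M" using test_fun_bounded[OF L] by blast
  note Gint = mean_integrable_on[OF test_fun_measurable[OF L] M]
  have Icont: "continuous_on {0..b} I" for b
    unfolding I_def by (rule indefinite_integral_continuous_1[OF Gint])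
  have ucont: "continuous_on {a..b} u" if "0 < a" for a b
    unfolding u_def
    by (intro continuous_intros mean_continuous[OF \<psi> that] continuous_on_subset[OF Icont]) (use that in auto)
  have Ideriv: "(I has_real_derivative ?G s) (at s)" if "0 < s" for s
  proof -
    have "isCont ?G s"
      using mean_continuous[OF L, of "s/2" "2 * s"] that
      by (intro continuous_on_interior[of "{s/2..2 * s}"]) (auto simp: interior_atLeastAtMost_real)
    then have "(I has_vector_derivative ?G s) (at s within {0..2 * s})"
      unfolding I_def using integral_has_vector_derivative_continuous_at[OF Gint, of s 0 "2 * s" "{}"] that
      by (simp add: continuous_at_imp_continuous_at_within)
    moreover have "at s within {0..2 * s} = at s" using that by (intro at_within_interior) auto
    ultimately show ?thesis by (simp add: has_real_derivative_iff_has_vector_derivative)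
  qed
  obtain \<epsilon> where \<epsilon>: "0 < \<epsilon>" "\<epsilon> < t0" and usgn: "\<And>s. s \<in> {t0 - \<epsilon>..t0 + \<epsilon>} \<Longrightarrow> 0 \<le> sgn (u t0) * u s"
  proof -
    have "isCont u t0"
      using ucont[of "t0/2" "2 * t0"] t0
      by (intro continuous_on_interior[of "{t0/2..2 * t0}"]) (auto simp: interior_atLeastAtMost_real)
    then obtain d where d: "0 < d" "\<And>s. dist s t0 < d \<Longrightarrow> dist (u s) (u t0) < \<bar>u t0\<bar>"
      using u0 unfolding continuous_at_eps_delta by (metis zero_less_abs_iff)
    show ?thesis
    proof (rule that[of "min (d/2) (t0/2)"])
      fix s assume "s \<in> {t0 - min (d/2) (t0/2)..t0 + min (d/2) (t0/2)}"
      then have "dist s t0 < d" using d(1) by (auto simp: dist_real_def)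
      from d(2)[OF this] show "0 \<le> sgn (u t0) * u s"
        by (auto simp: dist_real_def sgn_if abs_if split: if_splits)
    qed (use d t0 in auto)
  qed
  obtain \<eta> \<eta>' where \<eta>: "test_fun \<eta>" and s\<eta>': "smooth_fun \<eta>'"
    and \<eta>': "\<And>s. (\<eta> has_real_derivative \<eta>' s) (at s)"
    and \<eta>'_le: "\<And>s. 0 \<le> s \<Longrightarrow> \<eta>' s \<le> 0" and \<eta>'_neg: "\<eta>' t0 < 0"
    and \<eta>'_0: "\<And>s. 0 \<le> s \<Longrightarrow> \<epsilon> \<le> \<bar>s - t0\<bar> \<Longrightarrow> \<eta>' s = 0" and \<eta>_0: "\<And>s. t0 + \<epsilon> \<le> s \<Longrightarrow> \<eta> s = 0"
    using time_window[OF \<epsilon>] by blast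
  have c\<eta>': "continuous_on S \<eta>'" for S using s\<eta>' by (rule smooth_fun_continuous_on)
  let ?T = "t0 + \<epsilon>"
  let ?W = "\<lambda>s. \<eta> s * ?G s - \<eta>' s * mean \<psi> s"
  note weak = weak_heat_equation[OF \<psi> \<eta> \<eta>' c\<eta>']
  have "(?W has_integral \<eta> 0 * \<psi> 0) UNIV"
    using has_integral_integral_lborel[OF weak(1)] by (simp only: weak(2))
  then have i1: "(?W has_integral \<eta> 0 * \<psi> 0) {0..?T}"
  proof (rule has_integral_spike_set_eq[THEN iffD1, rotated 2])
    have "?W s = 0" if "s \<notin> {0..?T}" for s
      using that \<epsilon> by (cases "s < 0") (auto simp: mean_nonpos_time \<eta>_0 \<eta>'_0)
    then show "negligible {s \<in> UNIV - {0..?T}. ?W s \<noteq> 0}"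
      by (intro empty_imp_negligible) auto
  qed auto
  \<comment> \<open>Integration by parts.  At time \<open>0\<close> only continuity of \<open>I\<close> is available, as \<open>mean\<close> may jump there.\<close>
  have i2: "((\<lambda>s. \<eta> s * ?G s + \<eta>' s * I s) has_integral (\<eta> ?T * I ?T - \<eta> 0 * I 0)) {0..?T}"
  proof (rule fundamental_theorem_of_calculus_interior)
    show "continuous_on {0..?T} (\<lambda>s. \<eta> s * I s)"
      using \<eta> by (intro continuous_on_mult Icont) (auto simp: test_fun_def intro: smooth_fun_continuous_on)
    fix s assume "s \<in> {0<..<?T}"
    then show "((\<lambda>s. \<eta> s * I s) has_vector_derivative \<eta> s * ?G s + \<eta>' s * I s) (at s)"
      using DERIV_mult[OF \<eta>' Ideriv, of s]
      by (simp add: has_real_derivative_iff_has_vector_derivative algebra_simps)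
  qed (use t0 \<epsilon> in auto)
  have i3: "(\<eta>' has_integral (\<eta> ?T - \<eta> 0)) {0..?T}"
  proof (rule fundamental_theorem_of_calculus)
    show "(\<eta> has_vector_derivative \<eta>' s) (at s within {0..?T})" for s
      using \<eta>'[of s] by (simp add: has_real_derivative_iff_has_vector_derivative has_vector_derivative_at_within)
  qed (use t0 \<epsilon> in auto)
  have I0: "I 0 = 0" by (simp add: I_def)
  have "((\<lambda>s. ?W s - (\<eta> s * ?G s + \<eta>' s * I s) + \<psi> 0 * \<eta>' s) has_integral
      \<eta> 0 * \<psi> 0 - (\<eta> ?T * I ?T - \<eta> 0 * I 0) + \<psi> 0 * (\<eta> ?T - \<eta> 0)) {0..?T}"
    by (intro has_integral_add has_integral_diff i1 i2 has_integral_mult_right i3)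
  then have "((\<lambda>s. - (\<eta>' s * u s)) has_integral 0) {0..?T}"
    by (simp add: \<eta>_0 I0 u_def algebra_simps)
  then have "((\<lambda>s. \<eta>' s * u s) has_integral 0) {0..?T}"
    using has_integral_neg_iff[of "\<lambda>s. \<eta>' s * u s" 0] by simp
  then have "((\<lambda>s. (- sgn (u t0)) * (\<eta>' s * u s)) has_integral (- sgn (u t0)) * 0) {0..?T}"
    by (rule has_integral_mult_right)
  then have "((\<lambda>s. (- sgn (u t0)) * (\<eta>' s * u s)) has_integral 0) {t0 - \<epsilon>..?T}"
    unfolding mult_zero_right
    by (rule has_integral_spike_set_eq[THEN iffD1, rotated 2]) (use \<epsilon> \<eta>'_0 in \<open>auto intro!: empty_imp_negligible\<close>)
  then have "(- sgn (u t0)) * (\<eta>' t0 * u t0) = 0"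
  proof (intro has_integral_0_cbox_imp_0[of "t0 - \<epsilon>" ?T "\<lambda>s. (- sgn (u t0)) * (\<eta>' s * u s)" t0])
    show "continuous_on (cbox (t0 - \<epsilon>) ?T) (\<lambda>s. (- sgn (u t0)) * (\<eta>' s * u s))"
      using \<epsilon> by (auto intro!: continuous_intros ucont c\<eta>')
    show "0 \<le> (- sgn (u t0)) * (\<eta>' s * u s)" if "s \<in> box (t0 - \<epsilon>) ?T" for s
    proof -
      have "0 \<le> - \<eta>' s * (sgn (u t0) * u s)"
        using that \<epsilon> by (intro mult_nonneg_nonneg usgn) (auto simp: \<eta>'_le)
      then show ?thesis by (simp add: mult.left_commute)
    qed
  qed (use \<epsilon> in auto)
  then show False using u0 \<eta>'_neg by (simp add: sgn_if split: if_splits)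
qed

end

section \<open>Moments of the heat kernel\<close>

text \<open>
  \<open>gauge_gradient p\<close> is the carre du champ of \<open>p\<close> and the gauge, the cross term of the product rule.
\<close>

definition horizontal_laplacian :: "('n::finite heis \<Rightarrow> real) \<Rightarrow> 'n heis \<Rightarrow> real" where
  "horizontal_laplacian p x = (\<Sum>i\<in>UNIV. heis_D i (heis_D i p) x)"

definition gauge_gradient :: "('n::finite heis \<Rightarrow> real) \<Rightarrow> 'n heis \<Rightarrow> real" where
  "gauge_gradient p x = (\<Sum>i\<in>UNIV. heis_D i p x * heis_D i heis_gauge x)"

lemma smooth_horizontal_laplacian: "smooth_fun p \<Longrightarrow> smooth_fun (horizontal_laplacian p)"
  unfolding horizontal_laplacian_def by (intro smooth_fun_sum smooth_heis_D)

lemma heis_D_coord_power: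
  "heis_D i (\<lambda>x. x $ Some l ^ m) = (\<lambda>x. if i = l then real m * x $ Some l ^ (m - 1) else 0)"
  by (rule ext) (auto simp: heis_D_power smooth_fun_coord heis_D_Some)

lemma horizontal_laplacian_coord_power:
  "horizontal_laplacian (\<lambda>x. x $ Some l ^ m) x = real m * real (m - 1) * x $ Some l ^ (m - 2)"
proof -
  have "heis_D i (heis_D i (\<lambda>x. x $ Some l ^ m)) x
      = (if i = l then real m * real (m - 1) * x $ Some l ^ (m - 2) else 0)" for i
  proof (cases "i = l")
    case True
    have "heis_D l (\<lambda>x. real m * x $ Some l ^ (m - 1)) x
        = real m * (real (m - 1) * x $ Some l ^ (m - 1 - 1))"
      by (simp add: heis_D_cmult smooth_fun_power smooth_fun_coord heis_D_coord_power del: diff_diff_left)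
    then show ?thesis using True by (simp add: heis_D_coord_power numeral_2_eq_2)
  qed (simp add: heis_D_coord_power heis_D_const)
  then show ?thesis by (simp add: horizontal_laplacian_def)
qed

lemma gauge_gradient_coord_power:
  "gauge_gradient (\<lambda>x. x $ Some l ^ m) x
    = real m * x $ Some l ^ (m - 1) * (4 * hor_sq x * x $ Some l + 32 * x $ None * drift l x)"
proof -
  have "gauge_gradient (\<lambda>x. x $ Some l ^ m) x
     = (\<Sum>i\<in>UNIV. if i = l then real m * x $ Some l ^ (m - 1) * heis_D l heis_gauge x else 0)"
    unfolding gauge_gradient_def by (intro sum.cong) (auto simp: heis_D_coord_power)
  then show ?thesis by (simp add: heis_D_gauge)
qed

lemma heis_D_vertical_sq: "heis_D i (\<lambda>x. (x $ None)\<^sup>2) = (\<lambda>x. 2 * (x $ None * drift i x))"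
  by (rule ext) (simp add: heis_D_power smooth_fun_coord heis_D_None)

lemma horizontal_laplacian_vertical_sq: "horizontal_laplacian (\<lambda>x. (x $ None)\<^sup>2) x = hor_sq x / 2"
proof -
  have "heis_D i (heis_D i (\<lambda>x. (x $ None)\<^sup>2)) x = 2 * (drift i x)\<^sup>2" for i
    unfolding heis_D_vertical_sq by (simp add: heis_D_cmult heis_D_mult heis_D_None heis_D_drift
        smooth_fun.mult smooth_fun_coord smooth_fun.linear[OF bounded_linear_drift] power2_eq_square)
  then show ?thesis
    by (simp add: horizontal_laplacian_def sum_drift_sq flip: sum_distrib_left)
qed

lemma gauge_gradient_vertical_sq:
  "gauge_gradient (\<lambda>x. (x $ None)\<^sup>2) x = 16 * (x $ None)\<^sup>2 * hor_sq x"
proof -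
  have "gauge_gradient (\<lambda>x. (x $ None)\<^sup>2) x
     = (\<Sum>i\<in>UNIV. 8 * x $ None * hor_sq x * (x $ Some i * drift i x) + 64 * (x $ None)\<^sup>2 * (drift i x)\<^sup>2)"
    unfolding gauge_gradient_def
    unfolding heis_D_vertical_sq heis_D_gauge
    by (intro sum.cong) (auto simp: power2_eq_square algebra_simps)
  then show ?thesis
    by (simp add: sum.distrib sum_drift_sq sum_coord_drift flip: sum_distrib_left)
qed

lemma drift_sq_le: "(drift l x)\<^sup>2 \<le> hor_sq x / 4"
  unfolding sum_drift_sq[symmetric] by (rule member_le_sum) auto

lemma hor_sq_sq_le: "(hor_sq x)\<^sup>2 \<le> heis_gauge x" and vertical_sq_le: "16 * (x $ None)\<^sup>2 \<le> heis_gauge x"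
  by (auto simp: heis_gauge_def)

text \<open>
  The cross term of \<open>x_l^2\<close> and the gauge has degree \<open>4\<close>, like the gauge itself, so a bound by a
  multiple of the gauge has to hold; the constant comes from the inequality between arithmetic and
  geometric means.
\<close>

lemma gauge_gradient_coord_sq_le: "\<bar>gauge_gradient (\<lambda>x. (x $ Some l)\<^sup>2) x\<bar> \<le> 13 * heis_gauge x"
proof -
  let ?a = "x $ Some l" and ?d = "drift l x" and ?z = "x $ None" and ?S = "hor_sq x"
  have 1: "?a\<^sup>2 \<le> ?S" "?d\<^sup>2 \<le> ?S / 4" "0 \<le> ?S" by (rule hor_sq_coord_le drift_sq_le hor_sq_nonneg)+
  have "2 * (\<bar>?a\<bar> * \<bar>?d\<bar>) \<le> ?a\<^sup>2 + ?d\<^sup>2"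
    using sum_squares_bound[of "\<bar>?a\<bar>" "\<bar>?d\<bar>"] by (simp add: mult.assoc)
  with 1 have "\<bar>?a\<bar> * \<bar>?d\<bar> \<le> 5/8 * ?S" by linarith
  then have "\<bar>?a\<bar> * \<bar>?d\<bar> * \<bar>?z\<bar> \<le> 5/8 * ?S * \<bar>?z\<bar>" by (intro mult_right_mono) auto
  moreover have "8 * (?S * \<bar>?z\<bar>) \<le> heis_gauge x"
    using sum_squares_bound[of ?S "4 * \<bar>?z\<bar>"] by (simp add: heis_gauge_def power_mult_distrib)
  ultimately have "64 * (\<bar>?a\<bar> * \<bar>?d\<bar> * \<bar>?z\<bar>) \<le> 5 * heis_gauge x" by linarith
  moreover have "8 * (?S * ?a\<^sup>2) \<le> 8 * heis_gauge x"
    using mult_left_mono[OF 1(1,3)] hor_sq_sq_le[of x] by (simp add: power2_eq_square)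
  moreover have "\<bar>gauge_gradient (\<lambda>x. (x $ Some l)\<^sup>2) x\<bar> = \<bar>8 * (?S * ?a\<^sup>2) + 64 * (?a * ?d * ?z)\<bar>"
    unfolding gauge_gradient_coord_power[of l 2] by (simp add: power2_eq_square algebra_simps)
  moreover have "\<dots> \<le> 8 * (?S * ?a\<^sup>2) + 64 * (\<bar>?a\<bar> * \<bar>?d\<bar> * \<bar>?z\<bar>)"
    using 1 by (intro order_trans[OF abs_triangle_ineq]) (simp add: abs_mult)
  ultimately show ?thesis by linarith
qed

context heisenberg_heat
begin

text \<open>
  The evolution law beyond compactly supported functions.  The three bounds say that
  \<open>p\<close> has at most two degrees more than the weight \<open>w\<close>: they are invariant under dilations when
  \<open>p\<close> has degree \<open>d\<close> and \<open>w\<close> has degree \<open>d - 2\<close>.  They dominate the Laplacian of the truncations of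
  \<open>p\<close> by a multiple of \<open>w\<close>, whose mean is finite by assumption.  The finiteness of the mean of \<open>p\<close> is
  part of the conclusion: the truncations increase to \<open>p\<close> and their means converge.
\<close>

theorem moment_formula:
  assumes p: "smooth_fun p" "\<And>x. 0 \<le> p x" "p 0 = 0"
    and w: "\<And>s. integrable lborel (\<lambda>x. w x * h s x)" "mean w integrable_on {0..t}" "\<And>x. 0 \<le> w x"
    and b1: "\<And>x. \<bar>horizontal_laplacian p x\<bar> \<le> C * w x"
    and b2: "\<And>x. p x * hor_sq x \<le> C * (heis_gauge x * w x)"
    and b3: "\<And>x. \<bar>gauge_gradient p x\<bar> \<le> C * (heis_gauge x * w x)"
    and C: "0 \<le> C" and t: "0 < t"
  shows "integrable lborel (\<lambda>x. p x * h t x)"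
    and "mean p t = integral {0..t} (mean (horizontal_laplacian p))"
proof -
  obtain g :: "nat \<Rightarrow> real \<Rightarrow> real" where g: "\<And>k x. (g k has_real_derivative g (Suc k) x) (at x)"
    "\<And>k x. x \<le> 0 \<Longrightarrow> g k x = 0" "\<And>x. x > 0 \<Longrightarrow> g 0 x > 0" "mono (g 0)" "g 0 1 = 1"
    by (rule smooth_cutoff_exists, rule that)
  have gcont: "isCont (g j) s" for j s using g(1) by (rule DERIV_isCont)
  have "\<exists>M. \<forall>s\<le>1. \<bar>g j s\<bar> \<le> M" for j
  proof -
    have "compact (g j ` {0..1})"
      by (intro compact_continuous_image continuous_at_imp_continuous_on ballI gcont) auto
    then obtain M where "\<forall>y\<in>g j ` {0..1}. norm y \<le> M"
      using compact_imp_bounded bounded_iff by blast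
    then have "\<bar>g j s\<bar> \<le> max M 0" if "s \<le> 1" for s
      using that g(2)[of s j] by (cases "s \<le> 0") (auto simp: le_max_iff_disj)
    then show ?thesis by blast
  qed
  then obtain m where m: "\<And>j s. s \<le> 1 \<Longrightarrow> \<bar>g j s\<bar> \<le> m j" by metis
  define M where "M = max (m 0) (max (m 1) (m 2))"
  have M: "\<bar>g 0 s\<bar> \<le> M" "\<bar>g 1 s\<bar> \<le> M" "\<bar>g 2 s\<bar> \<le> M" if "s \<le> 1" for s
    using m[OF that, of 0] m[OF that, of 1] m[OF that, of 2] by (auto simp: M_def)
  have M0: "0 \<le> M" using M(1)[of 0] by linarith
  define c where "c k = 1 / (real k + 1)" for k
  have c: "0 < c k" for k by (simp add: c_def)
  define \<psi> where "\<psi> k x = p x * g 0 (1 - c k * heis_gauge x)" for k x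
  note cut = laplacian_cutoff[of g p, OF g(1) p(1)]
  have arg: "1 - c k * heis_gauge x \<le> 1" for k x
    using c[of k] gauge_nonneg[of x] by simp
  have \<psi>: "test_fun (\<psi> k)" for k
  proof -
    have "{x. \<psi> k x \<noteq> 0} \<subseteq> {x. heis_gauge x \<le> real k + 1}"
    proof
      fix x assume "x \<in> {x. \<psi> k x \<noteq> 0}"
      then have "0 < 1 - c k * heis_gauge x"
        using g(2)[of "1 - c k * heis_gauge x" 0] by (cases "1 - c k * heis_gauge x \<le> 0") (auto simp: \<psi>_def)
      then show "x \<in> {x. heis_gauge x \<le> real k + 1}" by (simp add: c_def field_simps)
    qed
    then have "bounded {x. \<psi> k x \<noteq> 0}"
      using bounded_gauge_le by (rule bounded_subset[rotated])
    then show ?thesis using cut(1)[of "c k"] by (simp add: test_fun_def \<psi>_def[abs_def])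
  qed
  let ?L = "\<lambda>k. sub_laplacian (\<psi> k)" and ?q = "horizontal_laplacian p"
  have L: "?L k x = - (g 0 (1 - c k * heis_gauge x) * ?q x
           - 2 * c k * g 1 (1 - c k * heis_gauge x) * gauge_gradient p x
           - c k * p x * g 1 (1 - c k * heis_gauge x) * ((8 * real CARD('n) + 16) * hor_sq x)
           + (c k)\<^sup>2 * p x * g 2 (1 - c k * heis_gauge x) * (16 * hor_sq x * heis_gauge x))" for k x
    using cut(2)[of "c k" x] by (simp add: \<psi>_def[abs_def] horizontal_laplacian_def gauge_gradient_def)
  \<comment> \<open>The four terms of \<open>laplacian_cutoff\<close> contribute \<open>1\<close>, \<open>2\<close>, \<open>8 n + 16\<close> and \<open>16\<close> times \<open>M C w\<close>.\<close>
  define C' where "C' = M * C * (8 * real CARD('n) + 35)"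
  have Lbound: "\<bar>?L k x\<bar> \<le> C' * w x" for k x
  proof (cases "c k * heis_gauge x < 1")
    case False
    then have "?L k x = 0" unfolding L by (simp add: g(2))
    then show ?thesis using M0 C w(3)[of x] by (simp add: C'_def)
  next
    case True
    let ?N = "heis_gauge x" and ?s = "1 - c k * heis_gauge x" and ?K = "8 * real CARD('n) + 16"
    have cN: "c k * ?N \<le> 1" "0 \<le> c k * ?N" using True c[of k] gauge_nonneg[of x] by auto
    have cNw: "c k * (C * (?N * w x)) \<le> C * w x"
      using mult_right_mono[OF cN(1), of "C * w x"] C w(3)[of x] by (simp add: mult_ac)
    have prod_le: "a * b \<le> M * (C * w x)" if "a \<le> M" "b \<le> C * w x" "0 \<le> b" for a b
      using that M0 by (intro mult_mono) auto
    have e0: "\<bar>g 0 ?s * ?q x\<bar> \<le> M * (C * w x)"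
      unfolding abs_mult by (intro prod_le M(1)[OF arg] b1 abs_ge_zero)
    have "c k * \<bar>gauge_gradient p x\<bar> \<le> C * w x"
      using mult_left_mono[OF b3[of x], of "c k"] c[of k] cNw by linarith
    then have e1: "\<bar>g 1 ?s\<bar> * (c k * \<bar>gauge_gradient p x\<bar>) \<le> M * (C * w x)"
      using c[of k] by (intro prod_le[OF M(2)[OF arg]]) auto
    have pS: "c k * (p x * hor_sq x) \<le> C * w x"
      using mult_left_mono[OF b2[of x], of "c k"] c[of k] cNw by linarith
    have pS0: "0 \<le> c k * (p x * hor_sq x)" using c[of k] p(2)[of x] hor_sq_nonneg[of x] by simp
    have e2: "\<bar>g 1 ?s\<bar> * (c k * (p x * hor_sq x)) \<le> M * (C * w x)"
      by (intro prod_le[OF M(2)[OF arg]] pS pS0)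
    have "(c k * ?N) * (c k * (p x * hor_sq x)) \<le> C * w x"
      using mult_mono[OF cN(1) pS _ pS0] by simp
    then have e3: "\<bar>g 2 ?s\<bar> * ((c k * ?N) * (c k * (p x * hor_sq x))) \<le> M * (C * w x)"
      by (rule prod_le[OF M(3)[OF arg] _ mult_nonneg_nonneg[OF cN(2) pS0]])
    have "\<bar>?L k x\<bar> \<le> \<bar>g 0 ?s * ?q x\<bar> + 2 * (\<bar>g 1 ?s\<bar> * (c k * \<bar>gauge_gradient p x\<bar>))
        + ?K * (\<bar>g 1 ?s\<bar> * (c k * (p x * hor_sq x)))
        + 16 * (\<bar>g 2 ?s\<bar> * ((c k * ?N) * (c k * (p x * hor_sq x))))"
    proof -
      let ?A = "g 0 ?s * ?q x" and ?B = "2 * c k * g 1 ?s * gauge_gradient p x"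
        and ?D = "c k * p x * g 1 ?s * (?K * hor_sq x)"
        and ?E = "(c k)\<^sup>2 * p x * g 2 ?s * (16 * hor_sq x * ?N)"
      have "\<bar>?B\<bar> = 2 * (\<bar>g 1 ?s\<bar> * (c k * \<bar>gauge_gradient p x\<bar>))"
        using c[of k] by (simp add: abs_mult)
      moreover have "\<bar>?D\<bar> = ?K * (\<bar>g 1 ?s\<bar> * (c k * (p x * hor_sq x)))"
        using c[of k] p(2)[of x] hor_sq_nonneg[of x] by (simp add: abs_mult)
      moreover have "\<bar>?E\<bar> = 16 * (\<bar>g 2 ?s\<bar> * ((c k * ?N) * (c k * (p x * hor_sq x))))"
        using c[of k] p(2)[of x] hor_sq_nonneg[of x] gauge_nonneg[of x]
        by (simp add: abs_mult power2_eq_square)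
      ultimately show ?thesis unfolding L by linarith
    qed
    also have "\<dots> \<le> M * (C * w x) + 2 * (M * (C * w x)) + ?K * (M * (C * w x)) + 16 * (M * (C * w x))"
      using e0 e1 e3 mult_left_mono[OF e2, of ?K] by linarith
    also have "\<dots> = C' * w x" by (simp add: C'_def algebra_simps)
    finally show ?thesis .
  qed
  have c0: "c \<longlonglongrightarrow> 0"
    unfolding c_def using LIMSEQ_inverse_real_of_nat by (simp add: inverse_eq_divide add.commute)
  have slim: "(\<lambda>k. 1 - c k * heis_gauge x) \<longlonglongrightarrow> 1" for x
    using tendsto_diff[OF tendsto_const tendsto_mult_left_zero[OF c0]] by force
  have glim: "(\<lambda>k. g j (1 - c k * heis_gauge x)) \<longlonglongrightarrow> g j 1" for j x
    by (rule isCont_tendsto_compose[OF gcont slim])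
  have Llim: "(\<lambda>k. ?L k x) \<longlonglongrightarrow> - ?q x" for x
  proof -
    have "(\<lambda>k. ?L k x) \<longlonglongrightarrow> - (g 0 1 * ?q x - 2 * 0 * g 1 1 * gauge_gradient p x
           - 0 * p x * g 1 1 * ((8 * real CARD('n) + 16) * hor_sq x)
           + 0\<^sup>2 * p x * g 2 1 * (16 * hor_sq x * heis_gauge x))"
      unfolding L by (intro tendsto_intros glim c0)
    then show ?thesis by (simp add: g(5))
  qed
  have [measurable]: "p \<in> borel_measurable borel" "?q \<in> borel_measurable borel"
    "\<psi> k \<in> borel_measurable borel" "?L k \<in> borel_measurable borel" for k
    using smooth_horizontal_laplacian[OF p(1)] p(1) \<psi> test_fun_sub_laplacian[OF \<psi>]
    by (auto intro: smooth_fun_measurable test_fun_measurable)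
  have dom: "integrable lborel (\<lambda>x. C' * (w x * h s x))" for s
    using w(1) by (rule integrable_mult_right)
  have domb: "norm (?L k x * h s x) \<le> C' * (w x * h s x)" for k x s
    using mult_right_mono[OF Lbound h_nonneg, of k x s x] h_nonneg[of s x] by (simp add: abs_mult mult.assoc)
  have meanlim: "(\<lambda>k. mean (?L k) s) \<longlonglongrightarrow> - mean ?q s" for s
  proof -
    have "(\<lambda>k. ?L k x * h s x) \<longlonglongrightarrow> - ?q x * h s x" for x
      by (intro tendsto_mult Llim tendsto_const)
    then have "(\<lambda>k. mean (?L k) s) \<longlonglongrightarrow> (LINT x|lborel. - ?q x * h s x)"
      unfolding mean_def
      by (intro integral_dominated_convergence[OF _ _ dom[of s]] AE_I2 domb) measurable
    then show ?thesis by (simp add: mean_def)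
  qed
  have meanb: "norm (mean (?L k) s) \<le> C' * mean w s" for k s
  proof -
    have "norm (mean (?L k) s) \<le> (LINT x|lborel. C' * (w x * h s x))"
      unfolding mean_def
    proof (rule Bochner_Integration.integral_norm_bound_integral[OF _ dom])
      show "integrable lborel (\<lambda>x. ?L k x * h s x)"
      proof (rule Bochner_Integration.integrable_bound[OF dom[of s]])
        show "AE x in lborel. norm (?L k x * h s x) \<le> norm (C' * (w x * h s x))"
          using domb[of k _ s] by (intro AE_I2) (simp add: order_trans[OF _ abs_ge_self])
      qed measurable
    qed (use domb in auto)
    then show ?thesis by (simp add: mean_def)
  qed
  have int: "mean (?L k) integrable_on {0..t}" for k
  proof -
    obtain B where "\<And>x. \<bar>?L k x\<bar> \<le> B" using test_fun_bounded[OF test_fun_sub_laplacian[OF \<psi>]] by blast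
    then show ?thesis by (intro mean_integrable_on) auto
  qed
  have "(\<lambda>k. integral {0..t} (mean (?L k))) \<longlonglongrightarrow> integral {0..t} (\<lambda>s. - mean ?q s)"
    by (rule dominated_convergence(2)[of _ _ "\<lambda>s. C' * mean w s"])
      (use int meanb meanlim w(2) in \<open>auto intro: integrable_on_mult_right\<close>)
  then have "(\<lambda>k. \<psi> k 0 - integral {0..t} (mean (?L k))) \<longlonglongrightarrow> 0 + integral {0..t} (mean ?q)"
    using tendsto_diff[OF tendsto_const, of _ _ _ 0] by (force simp: \<psi>_def p(3))
  then have "(\<lambda>k. mean (\<psi> k) t) \<longlonglongrightarrow> integral {0..t} (mean ?q)"
    using duhamel[OF \<psi> t] by simp
  then have lim: "(\<lambda>k. LINT x|lborel. \<psi> k x * h t x) \<longlonglongrightarrow> integral {0..t} (mean ?q)"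
    unfolding mean_def .
  have int\<psi>: "integrable lborel (\<lambda>x. \<psi> k x * h t x)" for k
  proof -
    obtain B where "\<And>x. \<bar>\<psi> k x\<bar> \<le> B" using test_fun_bounded[OF \<psi>] by blast
    then show ?thesis by (intro integrable_bounded_h(1)) auto
  qed
  have mono: "mono (\<lambda>k. \<psi> k x * h t x)" for x
  proof (rule monoI)
    fix j k :: nat assume "j \<le> k"
    then have "c k \<le> c j" by (simp add: c_def frac_le)
    then have "1 - c j * heis_gauge x \<le> 1 - c k * heis_gauge x"
      using gauge_nonneg[of x] by (simp add: mult_right_mono)
    then have "\<psi> j x \<le> \<psi> k x"
      unfolding \<psi>_def by (intro mult_left_mono monoD[OF g(4)] p(2))
    then show "\<psi> j x * h t x \<le> \<psi> k x * h t x" using h_nonneg by (rule mult_right_mono)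
  qed
  have plim: "(\<lambda>k. \<psi> k x * h t x) \<longlonglongrightarrow> p x * h t x" for x
    unfolding \<psi>_def using tendsto_mult[OF tendsto_mult[OF tendsto_const glim[of 0 x]] tendsto_const, of "p x" "h t x"]
    by (simp add: g(5))
  show "integrable lborel (\<lambda>x. p x * h t x)"
    by (rule integrable_monotone_convergence[OF int\<psi> _ _ lim]) (use mono plim in auto)
  show "mean p t = integral {0..t} (mean ?q)"
    unfolding mean_def[of p]
    by (rule Bochner_Integration.integral_monotone_convergence[OF int\<psi> _ _ lim]) (use mono plim in auto)
qed

lemma mean_const: "0 < t \<Longrightarrow> mean (\<lambda>x. c) t = c"
  by (simp add: mean_def h_mass)

lemma mean_cmult: "mean (\<lambda>x. c * f x) t = c * mean f t"
  by (simp add: mean_def mult.assoc)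

text \<open>
  Here the weight is the constant \<open>1\<close>, whose mean is the total mass of the heat kernel.
\<close>

lemma second_moment:
  assumes t: "0 < t"
  shows "integrable lborel (\<lambda>x. (x $ Some l)\<^sup>2 * h t x)" and "mean (\<lambda>x. (x $ Some l)\<^sup>2) t = 2 * t"
proof -
  let ?p = "\<lambda>x :: 'n heis. (x $ Some l)\<^sup>2"
  have S: "?p x * hor_sq x \<le> heis_gauge x" for x
    using mult_right_mono[OF hor_sq_coord_le hor_sq_nonneg, of x l x] hor_sq_sq_le[of x]
    by (simp add: power2_eq_square)
  have lap: "horizontal_laplacian ?p = (\<lambda>x. 2)"
    by (rule ext) (simp add: horizontal_laplacian_coord_power)
  note mf = moment_formula[of ?p "\<lambda>x. 1" t 13]
  have prems: "smooth_fun ?p" "\<And>s. integrable lborel (\<lambda>x. 1 * h s x)" "mean (\<lambda>x. 1) integrable_on {0..t}"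
    using mean_integrable_on[of "\<lambda>x. 1" 1] by (auto intro: smooth_fun_power smooth_fun_coord h_integrable)
  have S13: "?p x * hor_sq x \<le> 13 * (heis_gauge x * 1)" for x
    using S[of x] gauge_nonneg[of x] by simp
  show "integrable lborel (\<lambda>x. ?p x * h t x)"
    by (rule mf(1)) (use prems t S13 gauge_gradient_coord_sq_le in \<open>auto simp: lap\<close>)
  have "mean ?p t = integral {0..t} (mean (\<lambda>x. 2))"
    unfolding lap[symmetric]
    by (rule mf(2)) (use prems t S13 gauge_gradient_coord_sq_le in \<open>auto simp: lap\<close>)
  \<comment> \<open>The integrands differ at time \<open>0\<close>, where the heat kernel has no mass.\<close>
  also have "\<dots> = integral {0..t} (\<lambda>s. 2)"
    by (rule integral_spike[of "{0}"]) (auto simp: mean_const)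
  also have "\<dots> = 2 * t" using t by simp
  finally show "mean ?p t = 2 * t" .
qed

lemma mean_coord_sq: "0 \<le> t \<Longrightarrow> mean (\<lambda>x. (x $ Some l)\<^sup>2) t = 2 * t"
  using second_moment(2)[of t] mean_nonpos_time[of t] by (cases "t = 0") auto

lemma integrable_coord_sq: "integrable lborel (\<lambda>x. (x $ Some l)\<^sup>2 * h t x)"
  using second_moment(1)[of t] by (cases "0 < t") (auto simp: h_nonpos_time)

lemma integrable_hor_sq: "integrable lborel (\<lambda>x. hor_sq x * h t x)"
  unfolding hor_sq_def sum_distrib_right by (intro Bochner_Integration.integrable_sum integrable_coord_sq)

lemma mean_hor_sq: "0 \<le> t \<Longrightarrow> mean hor_sq t = 4 * real CARD('n) * t"
proof -
  assume t: "0 \<le> t"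
  have "mean hor_sq t = (\<Sum>l\<in>UNIV. mean (\<lambda>x. (x $ Some l)\<^sup>2) t)"
    unfolding mean_def hor_sq_def sum_distrib_right
    by (intro Bochner_Integration.integral_sum integrable_coord_sq)
  then show ?thesis using t by (simp add: mean_coord_sq)
qed

lemma mean_hor_sq_integrable_on: "mean hor_sq integrable_on {0..t}"
proof -
  have "(\<lambda>s. 4 * real CARD('n) * s) integrable_on {0..t}"
    by (intro integrable_continuous_interval continuous_intros)
  then show ?thesis
    by (rule integrable_eq) (auto simp: mean_hor_sq)
qed

lemma integral_linear_weight:
  assumes "0 \<le> (t::real)" shows "integral {0..t} (\<lambda>s. a * s) = a * t\<^sup>2 / 2"
proof -
  have "((\<lambda>s. a * s) has_integral (a * t\<^sup>2 / 2 - a * 0\<^sup>2 / 2)) {0..t}"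
    using assms
    by (intro fundamental_theorem_of_calculus)
      (auto intro!: derivative_eq_intros simp flip: has_real_derivative_iff_has_vector_derivative)
  from integral_unique[OF this] show ?thesis by simp
qed

text \<open>
  Now the weight is \<open>hor_sq\<close>, whose mean is known from the second moments.  The square \<open>x_l^2\<close>
  factors out of the cross term of \<open>x_l^4\<close> and the gauge, which reduces its bound to the one for
  \<open>x_l^2\<close>.
\<close>

lemma fourth_moment:
  assumes t: "0 < t"
  shows "mean (\<lambda>x. x $ Some l ^ 4) t = 12 * t\<^sup>2"
proof -
  let ?p = "\<lambda>x :: 'n heis. x $ Some l ^ 4"
  let ?q = "\<lambda>x :: 'n heis. (x $ Some l)\<^sup>2"
  have lap: "horizontal_laplacian ?p = (\<lambda>x. 12 * ?q x)"
    by (rule ext) (simp add: horizontal_laplacian_coord_power)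
  have le: "?q x \<le> hor_sq x" "0 \<le> hor_sq x" for x :: "'n heis" by (rule hor_sq_coord_le hor_sq_nonneg)+
  have pq: "?p x = ?q x * ?q x" for x :: "'n heis" by (simp add: power4_eq_xxxx power2_eq_square)
  have "?p x * hor_sq x \<le> heis_gauge x * hor_sq x" for x :: "'n heis"
    unfolding pq using mult_mono[OF le(1,1,2)] hor_sq_sq_le[of x]
    by (intro mult_right_mono le order_trans[OF _ hor_sq_sq_le]) (simp add: power2_eq_square)
  then have S: "?p x * hor_sq x \<le> 26 * (heis_gauge x * hor_sq x)" for x :: "'n heis"
    using mult_nonneg_nonneg[OF gauge_nonneg[of x] le(2)[of x]] by (smt (verit))
  have grad: "\<bar>gauge_gradient ?p x\<bar> \<le> 26 * (heis_gauge x * hor_sq x)" for x :: "'n heis"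
  proof -
    have "gauge_gradient ?p x = 2 * ?q x * gauge_gradient ?q x"
      unfolding gauge_gradient_coord_power by (simp add: power2_eq_square power3_eq_cube)
    then have "\<bar>gauge_gradient ?p x\<bar> = 2 * (?q x * \<bar>gauge_gradient ?q x\<bar>)" by (simp add: abs_mult)
    also have "\<dots> \<le> 2 * (hor_sq x * (13 * heis_gauge x))"
      by (intro mult_left_mono mult_mono le gauge_gradient_coord_sq_le) auto
    finally show ?thesis by (simp add: mult.commute)
  qed
  have lb: "\<bar>horizontal_laplacian ?p x\<bar> \<le> 26 * hor_sq x" for x
    unfolding lap using le[of x] by simp
  have "mean ?p t = integral {0..t} (mean (horizontal_laplacian ?p))"
    by (rule moment_formula(2)[OF _ _ _ integrable_hor_sq mean_hor_sq_integrable_on hor_sq_nonneg lb S grad])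
      (use t in \<open>auto intro: smooth_fun_power smooth_fun_coord\<close>)
  also have "\<dots> = integral {0..t} (\<lambda>s. 24 * s)"
    by (rule integral_cong) (auto simp: lap mean_cmult mean_coord_sq)
  finally show ?thesis using t by (simp add: integral_linear_weight)
qed

lemma vertical_second_moment:
  assumes t: "0 < t"
  shows "mean (\<lambda>x. (x $ None)\<^sup>2) t = real CARD('n) * t\<^sup>2"
proof -
  let ?p = "\<lambda>x :: 'n heis. (x $ None)\<^sup>2"
  have lap: "horizontal_laplacian ?p = (\<lambda>x. 1/2 * hor_sq x)"
    by (rule ext) (simp add: horizontal_laplacian_vertical_sq)
  have z: "16 * ?p x * hor_sq x \<le> heis_gauge x * hor_sq x" for x :: "'n heis"
    by (intro mult_right_mono vertical_sq_le hor_sq_nonneg)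
  have S: "?p x * hor_sq x \<le> 1 * (heis_gauge x * hor_sq x)" for x :: "'n heis"
    using z[of x] mult_nonneg_nonneg[OF zero_le_power2[of "x $ None"] hor_sq_nonneg[of x]] by linarith
  have grad: "\<bar>gauge_gradient ?p x\<bar> \<le> 1 * (heis_gauge x * hor_sq x)" for x :: "'n heis"
    using z[of x] hor_sq_nonneg[of x] by (simp add: gauge_gradient_vertical_sq)
  have lb: "\<bar>horizontal_laplacian ?p x\<bar> \<le> 1 * hor_sq x" for x
    unfolding lap using hor_sq_nonneg[of x] by simp
  have "mean ?p t = integral {0..t} (mean (horizontal_laplacian ?p))"
    by (rule moment_formula(2)[OF _ _ _ integrable_hor_sq mean_hor_sq_integrable_on hor_sq_nonneg lb S grad])
      (use t in \<open>auto intro: smooth_fun_power smooth_fun_coord\<close>)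
  also have "\<dots> = integral {0..t} (\<lambda>s. 2 * real CARD('n) * s)"
    unfolding lap mean_cmult by (rule integral_cong) (simp add: mean_hor_sq)
  finally show ?thesis using t by (simp add: integral_linear_weight)
qed

end

theorem proposition7p3:
  fixes h :: "real \<Rightarrow> 'n::finite heis \<Rightarrow> real"
  assumes "heat_kernel h"
  shows "(\<forall>i. (LINT x|lborel. (x $ Some i) ^ 4 * h 1 x) = 12) \<and>
         (LINT x|lborel. (x $ None)\<^sup>2 * h 1 x) = real CARD('n)"
proof -
  interpret heisenberg_heat h using assms by unfold_locales
  show ?thesis
    using fourth_moment[of 1] vertical_second_moment[of 1] by (simp add: mean_def)
qed

end
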